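(* Let $\Gamma$ be a finitely generated group, equipped with the word length function $l=l_\Gamma$ relative to some finite symmetric generating subset $S$, that fits in a short exact sequence of groups \[ 1 \rightarrow H \rightarrow \Gamma \stackrel{\pi}{\rightarrow} G \rightarrow 1. \] Equip $G$ with the word length function $l_G$ relative to $\pi(S)$. If $G$ is a finitely generated hyperbolic group in the sense of Gromov and if $H$, with the metric induced by the restriction of $l_\Gamma$ to $H$, has Hilbert space compression $\delta$, then the Hilbert space compression of $\Gamma$ (with the metric induced by $l_\Gamma$) is at least $\delta/5$.
   Context: A length function $l$ on a group induces the left-invariant metric $d(x,y)=l(x^{-1}y)$. The Hilbert space compression of a metric space $(X,d)$ is the supremum of all $\delta\in[0,1]$ for which there exist a Hilbert space $\mathcal{H}$, a map $f:X\to\mathcal{H}$ and constants $C,C'>0$, $D,D'\ge 0$ with \[ \tfrac{1}{C'}\,d(x,y)^{\delta}-D'\ \le\ \|f(x)-f(y)\|\ \le\ C\,d(x,y)+D\quad\text{for all }x,y\in X. \] *)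

theory Defs
  imports "HOL-Analysis.Analysis" "HOL-Algebra.Generated_Groups"
begin

section \<open>The real Hilbert space of square-summable families\<close>

typedef 'i ell2 = "{f :: 'i \<Rightarrow> real. (\<lambda>i. (f i)\<^sup>2) summable_on UNIV}"
  morphisms ell2_coord Abs_ell2
  by (rule exI[of _ "\<lambda>_. 0"]) simp

setup_lifting type_definition_ell2

lemma square_summable_mult:
  fixes f g :: "'i \<Rightarrow> real"
  assumes "(\<lambda>i. (f i)\<^sup>2) summable_on UNIV" "(\<lambda>i. (g i)\<^sup>2) summable_on UNIV"
  shows "(\<lambda>i. f i * g i) summable_on UNIV"
proof -
  have "(\<lambda>i. norm (f i * g i)) summable_on UNIV"
    by (rule abs_summable_product) (use assms in \<open>simp_all add: power2_eq_square\<close>)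
  then show ?thesis
    by (rule abs_summable_summable)
qed

lemma square_summable_add:
  fixes f g :: "'i \<Rightarrow> real"
  assumes "(\<lambda>i. (f i)\<^sup>2) summable_on UNIV" "(\<lambda>i. (g i)\<^sup>2) summable_on UNIV"
  shows "(\<lambda>i. (f i + g i)\<^sup>2) summable_on UNIV"
proof -
  have "(\<lambda>i. (f i)\<^sup>2 + 2 * (f i * g i) + (g i)\<^sup>2) summable_on UNIV"
    by (intro summable_on_add summable_on_cmult_right assms square_summable_mult)
  moreover have "(f i + g i)\<^sup>2 = (f i)\<^sup>2 + 2 * (f i * g i) + (g i)\<^sup>2" for i
    by (simp add: power2_sum)
  ultimately show ?thesis by simp
qed

lemma square_summable_scale:
  fixes f :: "'i \<Rightarrow> real"
  assumes "(\<lambda>i. (f i)\<^sup>2) summable_on UNIV"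
  shows "(\<lambda>i. (r * f i)\<^sup>2) summable_on UNIV"
  using summable_on_cmult_right[OF assms, of "r\<^sup>2"] by (simp add: power_mult_distrib)

instantiation ell2 :: (type) real_inner
begin

lift_definition zero_ell2 :: "'a ell2" is "\<lambda>_. 0" by simp

lift_definition plus_ell2 :: "'a ell2 \<Rightarrow> 'a ell2 \<Rightarrow> 'a ell2" is "\<lambda>f g i. f i + g i"
  by (rule square_summable_add)

lift_definition uminus_ell2 :: "'a ell2 \<Rightarrow> 'a ell2" is "\<lambda>f i. - f i" by simp

lift_definition minus_ell2 :: "'a ell2 \<Rightarrow> 'a ell2 \<Rightarrow> 'a ell2" is "\<lambda>f g i. f i - g i"
  subgoal for f g using square_summable_add[of f "\<lambda>i. - g i"] by simp
  done

lift_definition scaleR_ell2 :: "real \<Rightarrow> 'a ell2 \<Rightarrow> 'a ell2" is "\<lambda>r f i. r * f i"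
  by (rule square_summable_scale)

lift_definition inner_ell2 :: "'a ell2 \<Rightarrow> 'a ell2 \<Rightarrow> real" is "\<lambda>f g. \<Sum>\<^sub>\<infinity>i. f i * g i" .

definition norm_ell2 :: "'a ell2 \<Rightarrow> real" where "norm_ell2 x = sqrt (inner x x)"

definition dist_ell2 :: "'a ell2 \<Rightarrow> 'a ell2 \<Rightarrow> real" where "dist_ell2 x y = norm (x - y)"

definition sgn_ell2 :: "'a ell2 \<Rightarrow> 'a ell2" where "sgn_ell2 x = scaleR (inverse (norm x)) x"

definition uniformity_ell2 :: "('a ell2 \<times> 'a ell2) filter"
  where "uniformity_ell2 = (INF e\<in>{0 <..}. principal {(x, y). dist x y < e})"

definition open_ell2 :: "'a ell2 set \<Rightarrow> bool"
  where "open_ell2 S = (\<forall>x\<in>S. \<forall>\<^sub>F (x', y) in uniformity. x' = x \<longrightarrow> y \<in> S)"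

instance
proof
  fix x y z :: "'a ell2" and r s :: real
  show "x + y + z = x + (y + z)" "x + y = y + x" "0 + x = x" "- x + x = 0" "x - y = x + - y"
    "r *\<^sub>R (x + y) = r *\<^sub>R x + r *\<^sub>R y" "(r + s) *\<^sub>R x = r *\<^sub>R x + s *\<^sub>R x"
    "r *\<^sub>R s *\<^sub>R x = (r * s) *\<^sub>R x" "1 *\<^sub>R x = x"
    by (transfer; simp add: algebra_simps)+
  show "sgn x = scaleR (inverse (norm x)) x" by (rule sgn_ell2_def)
  show "dist x y = norm (x - y)" by (rule dist_ell2_def)
  show "uniformity = (INF e\<in>{0 <..}. principal {(x, y :: 'a ell2). dist x y < e})"
    by (rule uniformity_ell2_def)
  show "open U = (\<forall>x\<in>U. \<forall>\<^sub>F (x', y) in uniformity. x' = x \<longrightarrow> y \<in> U)" for U :: "'a ell2 set"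
    by (rule open_ell2_def)
  show "norm x = sqrt (inner x x)" by (rule norm_ell2_def)
  show "inner x y = inner y x"
    by transfer (simp add: mult.commute)
  show "inner (x + y) z = inner x z + inner y z"
    by transfer (simp add: distrib_right infsum_add square_summable_mult)
  show "inner (r *\<^sub>R x) y = r * inner x y"
    by transfer (simp add: mult.assoc infsum_cmult_right')
  show "0 \<le> inner x x"
    by transfer (simp add: infsum_nonneg)
  show "(inner x x = 0) = (x = 0)"
  proof transfer
    fix f :: "'a \<Rightarrow> real" assume f: "(\<lambda>i. (f i)\<^sup>2) summable_on UNIV"
    show "((\<Sum>\<^sub>\<infinity>i. f i * f i) = 0) = (f = (\<lambda>_. 0))"
    proof
      assume "(\<Sum>\<^sub>\<infinity>i. f i * f i) = 0"
      then have "f i * f i = 0" for i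
        by (intro nonneg_infsum_le_0D[of "\<lambda>i. f i * f i" UNIV])
          (use f in \<open>auto simp: power2_eq_square\<close>)
      then show "f = (\<lambda>_. 0)" by auto
    qed simp
  qed
qed

end

lemma norm_ell2_sq: "(norm x)\<^sup>2 = (\<Sum>\<^sub>\<infinity>i. (ell2_coord x i)\<^sup>2)"
  unfolding power2_norm_eq_inner by transfer (simp add: power2_eq_square)

lemma ell2_coord_summable: "(\<lambda>i. (ell2_coord x i)\<^sup>2) summable_on UNIV"
  using ell2_coord[of x] by simp

lemma sum_coord_le_norm_ell2:
  assumes "finite F"
  shows "(\<Sum>i\<in>F. (ell2_coord x i)\<^sup>2) \<le> (norm x)\<^sup>2"
  unfolding norm_ell2_sq
  by (rule finite_sum_le_infsum) (use assms ell2_coord_summable in auto)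

lemma abs_coord_le_norm_ell2: "\<bar>ell2_coord x i\<bar> \<le> norm x"
  using sum_coord_le_norm_ell2[of "{i}" x] abs_le_square_iff[of "ell2_coord x i" "norm x"] by simp

instance ell2 :: (type) complete_space
proof
  fix X :: "nat \<Rightarrow> 'a ell2"
  assume X: "Cauchy X"
  have cauchy: "Cauchy (\<lambda>n. ell2_coord (X n) i)" for i
  proof (rule metric_CauchyI)
    fix e :: real assume "e > 0"
    then obtain N where N: "\<And>m n. m \<ge> N \<Longrightarrow> n \<ge> N \<Longrightarrow> dist (X m) (X n) < e"
      using X unfolding Cauchy_def by blast
    have "dist (ell2_coord (X m) i) (ell2_coord (X n) i) < e" if "m \<ge> N" "n \<ge> N" for m n
      using abs_coord_le_norm_ell2[of "X m - X n" i] N[OF that]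
      by (simp add: dist_norm minus_ell2.rep_eq)
    then show "\<exists>N. \<forall>m\<ge>N. \<forall>n\<ge>N. dist (ell2_coord (X m) i) (ell2_coord (X n) i) < e"
      by blast
  qed
  define l where "l i = lim (\<lambda>n. ell2_coord (X n) i)" for i
  have l: "(\<lambda>n. ell2_coord (X n) i) \<longlonglongrightarrow> l i" for i
    using cauchy[of i] unfolding l_def by (simp add: Cauchy_convergent_iff convergent_LIMSEQ_iff)
  have key: "\<exists>N. \<forall>n\<ge>N. \<forall>F. finite F \<longrightarrow> (\<Sum>i\<in>F. (l i - ell2_coord (X n) i)\<^sup>2) \<le> e\<^sup>2"
    if "e > 0" for e
  proof -
    obtain N where N: "\<And>m n. m \<ge> N \<Longrightarrow> n \<ge> N \<Longrightarrow> dist (X m) (X n) < e"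
      using X \<open>e > 0\<close> unfolding Cauchy_def by blast
    have "(\<Sum>i\<in>F. (l i - ell2_coord (X n) i)\<^sup>2) \<le> e\<^sup>2" if "n \<ge> N" "finite F" for n F
    proof (rule LIMSEQ_le_const2)
      show "(\<lambda>m. \<Sum>i\<in>F. (ell2_coord (X m) i - ell2_coord (X n) i)\<^sup>2)
              \<longlonglongrightarrow> (\<Sum>i\<in>F. (l i - ell2_coord (X n) i)\<^sup>2)"
        by (intro tendsto_intros l)
      have "(\<Sum>i\<in>F. (ell2_coord (X m) i - ell2_coord (X n) i)\<^sup>2) \<le> e\<^sup>2" if "m \<ge> N" for m
      proof -
        have "(\<Sum>i\<in>F. (ell2_coord (X m) i - ell2_coord (X n) i)\<^sup>2) \<le> (norm (X m - X n))\<^sup>2"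
          using sum_coord_le_norm_ell2[OF \<open>finite F\<close>, of "X m - X n"]
          by (simp add: minus_ell2.rep_eq)
        also have "\<dots> \<le> e\<^sup>2"
          using N[OF \<open>m \<ge> N\<close> \<open>n \<ge> N\<close>] by (intro power_mono) (auto simp: dist_norm)
        finally show ?thesis .
      qed
      then show "\<exists>M. \<forall>m\<ge>M. (\<Sum>i\<in>F. (ell2_coord (X m) i - ell2_coord (X n) i)\<^sup>2) \<le> e\<^sup>2"
        by blast
    qed
    then show ?thesis by blast
  qed
  have diff: "(\<lambda>i. (l i - ell2_coord (X n) i)\<^sup>2) summable_on UNIV"
    if "\<And>F. finite F \<Longrightarrow> (\<Sum>i\<in>F. (l i - ell2_coord (X n) i)\<^sup>2) \<le> c" for n c
    by (rule nonneg_bdd_above_summable_on) (use that in \<open>auto intro!: bdd_aboveI\<close>)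
  obtain M where "\<And>n F. n \<ge> M \<Longrightarrow> finite F \<Longrightarrow> (\<Sum>i\<in>F. (l i - ell2_coord (X n) i)\<^sup>2) \<le> 1\<^sup>2"
    using key[of 1] by auto
  then have "(\<lambda>i. (l i - ell2_coord (X M) i)\<^sup>2) summable_on UNIV"
    by (intro diff) auto
  from square_summable_add[OF this ell2_coord_summable[of "X M"]]
  have l2: "(\<lambda>i. (l i)\<^sup>2) summable_on UNIV" by simp
  define x where "x = Abs_ell2 l"
  have x: "ell2_coord x = l"
    unfolding x_def using l2 by (simp add: Abs_ell2_inverse)
  have "X \<longlonglongrightarrow> x"
  proof (rule LIMSEQ_I)
    fix e :: real assume "e > 0"
    then obtain N
      where N: "\<And>n F. n \<ge> N \<Longrightarrow> finite F \<Longrightarrow> (\<Sum>i\<in>F. (l i - ell2_coord (X n) i)\<^sup>2) \<le> (e/2)\<^sup>2"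
      using key[of "e/2"] by auto
    have "norm (X n - x) < e" if "n \<ge> N" for n
    proof -
      have "(norm (x - X n))\<^sup>2 \<le> (e/2)\<^sup>2"
        unfolding norm_ell2_sq
        by (rule infsum_le_finite_sums[OF ell2_coord_summable])
          (use N that in \<open>simp add: minus_ell2.rep_eq x\<close>)
      then have "norm (x - X n) \<le> e/2"
        using \<open>e > 0\<close> by (simp add: power2_le_iff_abs_le)
      then show ?thesis using \<open>e > 0\<close> by (simp add: norm_minus_commute)
    qed
    then show "\<exists>N. \<forall>n\<ge>N. norm (X n - x) < e" by blast
  qed
  then show "convergent X" by (rule convergentI)
qed


section \<open>Every map into a Hilbert space can be realised in square-summable families\<close>

definition orthonormal :: "'h::real_inner set \<Rightarrow> bool"
  where "orthonormal B \<longleftrightarrow> (\<forall>b\<in>B. norm b = 1) \<and> (\<forall>b\<in>B. \<forall>c\<in>B. b \<noteq> c \<longrightarrow> inner b c = 0)"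

lemma orthonormal_inner:
  assumes "orthonormal B" "b \<in> B" "c \<in> B"
  shows "inner b c = (if b = c then 1 else 0)"
  using assms unfolding orthonormal_def by (auto simp: dot_square_norm)

lemma maximal_orthonormal_exists:
  obtains B :: "'h::real_inner set"
  where "orthonormal B" "\<And>v. (\<And>b. b \<in> B \<Longrightarrow> inner v b = 0) \<Longrightarrow> v = 0"
proof -
  have "\<exists>B\<in>Collect orthonormal. \<forall>C\<in>Collect orthonormal. B \<subseteq> C \<longrightarrow> C = (B :: 'h set)"
  proof (rule subset_Zorn')
    fix \<C> :: "'h set set" assume \<C>: "subset.chain (Collect orthonormal) \<C>"
    show "\<Union>\<C> \<in> Collect orthonormal"
      unfolding mem_Collect_eq orthonormal_def
    proof (intro conjI ballI impI)
      fix b assume "b \<in> \<Union>\<C>"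
      then show "norm b = 1" using \<C> by (auto simp: subset.chain_def orthonormal_def)
    next
      fix b c assume "b \<in> \<Union>\<C>" "c \<in> \<Union>\<C>" and ne: "b \<noteq> c"
      then obtain U V where "U \<in> \<C>" "V \<in> \<C>" "b \<in> U" "c \<in> V" by blast
      then obtain W where "W \<in> \<C>" "b \<in> W" "c \<in> W"
        using \<C> unfolding subset_chain_def by (metis subsetD)
      then show "inner b c = 0"
        using \<C> ne by (auto simp: subset.chain_def orthonormal_def)
    qed
  qed
  then obtain B :: "'h set"
    where B: "orthonormal B" and max: "\<And>C. orthonormal C \<Longrightarrow> B \<subseteq> C \<Longrightarrow> C = B"
    by blast
  have "v = 0" if v: "\<And>b. b \<in> B \<Longrightarrow> inner v b = 0" for v
  proof (rule ccontr)
    assume "v \<noteq> 0"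
    have v': "inner b v = 0" if "b \<in> B" for b
      using v[OF that] by (simp add: inner_commute)
    have "orthonormal (insert (sgn v) B)"
      using B v v' \<open>v \<noteq> 0\<close> unfolding orthonormal_def
      by (auto simp: norm_sgn sgn_div_norm)
    then have "sgn v \<in> B" using max[of "insert (sgn v) B"] by blast
    then have "inner v (sgn v) = 0" by (rule v)
    then show False using \<open>v \<noteq> 0\<close> by (simp add: sgn_div_norm)
  qed
  with B show thesis by (rule that)
qed

lemma norm_sum_orthonormal:
  fixes B :: "'h::real_inner set"
  assumes "orthonormal B" "finite F" "F \<subseteq> B"
  shows "(norm (\<Sum>b\<in>F. a b *\<^sub>R b))\<^sup>2 = (\<Sum>b\<in>F. (a b)\<^sup>2)"
proof -
  have "(norm (\<Sum>b\<in>F. a b *\<^sub>R b))\<^sup>2 = (\<Sum>b\<in>F. \<Sum>c\<in>F. a b * (a c * inner b c))"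
    by (simp add: power2_norm_eq_inner inner_sum_left inner_sum_right sum_distrib_left inner_commute mult.left_commute)
  also have "\<dots> = (\<Sum>b\<in>F. \<Sum>c\<in>F. if b = c then a b * a c else 0)"
    by (intro sum.cong refl) (use assms(3) in \<open>simp add: subset_iff orthonormal_inner[OF assms(1)]\<close>)
  also have "\<dots> = (\<Sum>b\<in>F. (a b)\<^sup>2)"
    using assms(2) by (simp add: power2_eq_square)
  finally show ?thesis .
qed

lemma parseval:
  fixes v :: "'h::{real_inner, complete_space}"
  assumes B: "orthonormal B" and total: "\<And>v. (\<And>b. b \<in> B \<Longrightarrow> inner v b = 0) \<Longrightarrow> v = 0"
  shows "((\<lambda>b. (inner v b)\<^sup>2) has_sum (norm v)\<^sup>2) B"
proof -
  let ?s = "\<lambda>b. inner v b *\<^sub>R b"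
  have bessel: "(\<Sum>b\<in>F. (inner v b)\<^sup>2) \<le> (norm v)\<^sup>2" if F: "finite F" "F \<subseteq> B" for F
  proof -
    have "0 \<le> (norm (v - sum ?s F))\<^sup>2" by simp
    also have "\<dots> = (norm v)\<^sup>2 - 2 * inner v (sum ?s F) + (norm (sum ?s F))\<^sup>2"
      by (simp add: power2_norm_eq_inner inner_diff_left inner_diff_right inner_commute)
    also have "inner v (sum ?s F) = (\<Sum>b\<in>F. (inner v b)\<^sup>2)"
      by (simp add: inner_sum_right power2_eq_square)
    also have "(norm (sum ?s F))\<^sup>2 = (\<Sum>b\<in>F. (inner v b)\<^sup>2)"
      by (rule norm_sum_orthonormal[OF B F])
    finally show ?thesis by simp
  qed
  have summ: "(\<lambda>b. (inner v b)\<^sup>2) summable_on B"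
    by (rule nonneg_bdd_above_summable_on) (use bessel in \<open>auto intro!: bdd_aboveI\<close>)
  then obtain S where S: "((\<lambda>b. (inner v b)\<^sup>2) has_sum S) B"
    by (auto simp: summable_on_def)
  have "\<exists>P. eventually P (finite_subsets_at_top B) \<and>
            (\<forall>F F'. P F \<and> P F' \<longrightarrow> dist (sum ?s F) (sum ?s F') < e)" if "e > 0" for e
  proof -
    obtain F0 where F0: "finite F0" "F0 \<subseteq> B" "dist (\<Sum>b\<in>F0. (inner v b)\<^sup>2) S \<le> (e/3)\<^sup>2"
      using has_sum_finite_approximation[OF S, of "(e/3)\<^sup>2"] \<open>e > 0\<close> by auto
    define P where "P F \<longleftrightarrow> finite F \<and> F0 \<subseteq> F \<and> F \<subseteq> B" for F
    have close: "dist (sum ?s F) (sum ?s F0) \<le> e/3" if "P F" for F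
    proof -
      have F: "finite F" "F0 \<subseteq> F" "F \<subseteq> B" using that by (auto simp: P_def)
      have "(dist (sum ?s F) (sum ?s F0))\<^sup>2 = (norm (sum ?s (F - F0)))\<^sup>2"
        using F by (simp add: dist_norm sum_diff)
      also have "\<dots> = (\<Sum>b\<in>F - F0. (inner v b)\<^sup>2)"
        by (rule norm_sum_orthonormal[OF B]) (use F in auto)
      also have "\<dots> = (\<Sum>b\<in>F. (inner v b)\<^sup>2) - (\<Sum>b\<in>F0. (inner v b)\<^sup>2)"
        using F by (simp add: sum_diff)
      also have "(\<Sum>b\<in>F. (inner v b)\<^sup>2) \<le> S"
        by (rule finite_sum_le_has_sum[OF S]) (use F in auto)
      also have "S - (\<Sum>b\<in>F0. (inner v b)\<^sup>2) \<le> (e/3)\<^sup>2"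
        using F0(3) by (simp add: dist_real_def)
      finally show ?thesis using \<open>e > 0\<close> by (simp add: power2_le_iff_abs_le)
    qed
    have "dist (sum ?s F) (sum ?s F') < e" if "P F" "P F'" for F F'
      using close[OF that(1)] close[OF that(2)]
        dist_triangle2[of "sum ?s F" "sum ?s F'" "sum ?s F0"] \<open>e > 0\<close> by linarith
    moreover have "eventually P (finite_subsets_at_top B)"
      unfolding eventually_finite_subsets_at_top P_def using F0 by blast
    ultimately show ?thesis by blast
  qed
  then have "cauchy_filter (filtermap (sum ?s) (finite_subsets_at_top B))"
    by (simp add: cauchy_filter_metric_filtermap)
  then obtain w where "(sum ?s \<longlongrightarrow> w) (finite_subsets_at_top B)"
    using complete_uniform[where S = "UNIV :: 'h set"] complete_UNIV
    by (force simp add: filterlim_def)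
  then have w: "(?s has_sum w) B" by (simp add: has_sum_def)
  have "v - w = 0"
  proof (rule total)
    fix c assume c: "c \<in> B"
    have "((\<lambda>b. inner (?s b) c) has_sum inner w c) B"
      by (rule has_sum_bounded_linear[OF bounded_linear_inner_left w])
    moreover have "((\<lambda>b. inner (?s b) c) has_sum inner v c) B"
    proof -
      have "((\<lambda>b. inner (?s b) c) has_sum (\<Sum>b\<in>{c}. inner (?s b) c)) {c}"
        by (rule has_sum_finite) simp
      also have "?this \<longleftrightarrow> ((\<lambda>b. inner (?s b) c) has_sum (\<Sum>b\<in>{c}. inner (?s b) c)) B"
        by (rule has_sum_cong_neutral) (use c orthonormal_inner[OF B _ c] in auto)
      finally show ?thesis using orthonormal_inner[OF B c c] by simp
    qed
    ultimately have "inner w c = inner v c" by (rule has_sum_unique)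
    then show "inner (v - w) c = 0" by (simp add: inner_diff_left)
  qed
  then have "(?s has_sum v) B" using w by simp
  from has_sum_bounded_linear[OF bounded_linear_inner_right[of v] this]
  show ?thesis by (simp add: power2_norm_eq_inner) (simp add: power2_eq_square)
qed

lemma hilbert_map_realised_in_ell2:
  fixes f :: "'a \<Rightarrow> 'h::{real_inner, complete_space}"
  shows "\<exists>g :: 'a \<Rightarrow> ('a \<times> nat) ell2. \<forall>x y. norm (g x - g y) = norm (f x - f y)"
proof -
  obtain B :: "'h set" where B: "orthonormal B"
    and total: "\<And>v. (\<And>b. b \<in> B \<Longrightarrow> inner v b = 0) \<Longrightarrow> v = 0"
    using maximal_orthonormal_exists by blast
  note parseval = parseval[OF B total]
  define A where "A x = {b\<in>B. inner (f x) b \<noteq> 0}" for x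
  have "countable (A x)" for x
    using summable_countable_real[OF has_sum_imp_summable[OF parseval[of "f x"]]]
    by (simp add: A_def)
  then have A: "inj_on (to_nat_on (A x)) (A x)" for x
    by (rule inj_on_to_nat_on)
  define B' where "B' = (\<Union>x. A x)"
  define p where "p b = (SOME x. b \<in> A x)" for b
  define \<phi> where "\<phi> b = (p b, to_nat_on (A (p b)) b)" for b
  have p: "b \<in> A (p b)" if "b \<in> B'" for b
    using that unfolding B'_def p_def by (auto intro: someI)
  have inj: "inj_on \<phi> B'"
  proof (rule inj_onI)
    fix b c assume bc: "b \<in> B'" "c \<in> B'" "\<phi> b = \<phi> c"
    then have "p b = p c" "to_nat_on (A (p b)) b = to_nat_on (A (p b)) c"
      by (auto simp: \<phi>_def)
    then show "b = c" using p[OF bc(1)] p[OF bc(2)] A inj_onD by metis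
  qed
  define k where "k v i = (if i \<in> \<phi> ` B' then inner v (inv_into B' \<phi> i) else 0)" for v i
  have k_diff: "k (v - w) i = k v i - k w i" for v w i
    by (simp add: k_def inner_diff_left)
  have k_sum: "((\<lambda>i. (k v i)\<^sup>2) has_sum (norm v)\<^sup>2) UNIV"
    if v: "\<And>b. b \<in> B \<Longrightarrow> b \<notin> B' \<Longrightarrow> inner v b = 0" for v
  proof -
    have "((\<lambda>b. (inner v b)\<^sup>2) has_sum (norm v)\<^sup>2) B'"
      using parseval[of v]
      by (subst has_sum_cong_neutral[where T = B and g = "\<lambda>b. (inner v b)\<^sup>2"])
        (use v in \<open>auto simp: B'_def A_def\<close>)
    also have "?this \<longleftrightarrow> (((\<lambda>i. (k v i)\<^sup>2) \<circ> \<phi>) has_sum (norm v)\<^sup>2) B'"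
      by (rule has_sum_cong) (simp add: k_def inj)
    also have "\<dots> \<longleftrightarrow> ((\<lambda>i. (k v i)\<^sup>2) has_sum (norm v)\<^sup>2) (\<phi> ` B')"
      by (rule has_sum_reindex[OF inj, symmetric])
    also have "\<dots> \<longleftrightarrow> ((\<lambda>i. (k v i)\<^sup>2) has_sum (norm v)\<^sup>2) UNIV"
      by (rule has_sum_cong_neutral) (auto simp: k_def)
    finally show ?thesis .
  qed
  have f0: "inner (f x) b = 0" if "b \<in> B" "b \<notin> B'" for x b
    using that by (auto simp: B'_def A_def)
  define g where "g x = Abs_ell2 (k (f x))" for x
  have g: "ell2_coord (g x) = k (f x)" for x
    unfolding g_def
    by (rule Abs_ell2_inverse) (use has_sum_imp_summable[OF k_sum] f0 in simp)
  have "norm (g x - g y) = norm (f x - f y)" for x y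
  proof -
    have "(norm (g x - g y))\<^sup>2 = (\<Sum>\<^sub>\<infinity>i. (k (f x - f y) i)\<^sup>2)"
      by (simp add: norm_ell2_sq minus_ell2.rep_eq g k_diff)
    also have "\<dots> = (norm (f x - f y))\<^sup>2"
      by (rule infsumI, rule k_sum) (simp add: inner_diff_left f0)
    finally show ?thesis by simp
  qed
  then show ?thesis by blast
qed


section \<open>Hilbert space compression\<close>

text \<open>
  The existential quantifier over all Hilbert spaces cannot be written inside a formula, since
  types cannot be quantified there. It is replaced by the single Hilbert space of
  square-summable families indexed by \<open>'a \<times> nat\<close>, where \<open>'a\<close> is the type of the points. By
  \<open>hilbert_map_realised_in_ell2\<close> every map from \<open>'a\<close> into any Hilbert space whatsoever
  can be replaced by a map into this one without changing a single distance, so nothing is lost;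
  \<open>compression_exponentI\<close> below states this for the definition. (A complex Hilbert
  space is a real one under the real part of its inner product, with the same norm.)
\<close>

definition compression_exponent :: "'a set \<Rightarrow> ('a \<Rightarrow> 'a \<Rightarrow> real) \<Rightarrow> real \<Rightarrow> bool"
  where "compression_exponent X d \<delta> \<longleftrightarrow> 0 \<le> \<delta> \<and> \<delta> \<le> 1 \<and>
    (\<exists>(f :: 'a \<Rightarrow> ('a \<times> nat) ell2) C C' D D'. C > 0 \<and> C' > 0 \<and> D \<ge> 0 \<and> D' \<ge> 0 \<and>
      (\<forall>x\<in>X. \<forall>y\<in>X. 1 / C' * d x y powr \<delta> - D' \<le> norm (f x - f y) \<and>
                    norm (f x - f y) \<le> C * d x y + D))"

definition hilbert_compression :: "'a set \<Rightarrow> ('a \<Rightarrow> 'a \<Rightarrow> real) \<Rightarrow> real"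
  where "hilbert_compression X d = Sup {\<delta>. compression_exponent X d \<delta>}"

lemma compression_exponentI:
  fixes f :: "'a \<Rightarrow> 'h::{real_inner, complete_space}"
  assumes "0 \<le> \<delta>" "\<delta> \<le> 1" "C > 0" "C' > 0" "D \<ge> 0" "D' \<ge> 0"
    and "\<And>x y. x \<in> X \<Longrightarrow> y \<in> X \<Longrightarrow> 1 / C' * d x y powr \<delta> - D' \<le> norm (f x - f y)"
    and "\<And>x y. x \<in> X \<Longrightarrow> y \<in> X \<Longrightarrow> norm (f x - f y) \<le> C * d x y + D"
  shows "compression_exponent X d \<delta>"
proof -
  obtain g :: "'a \<Rightarrow> ('a \<times> nat) ell2" where "\<And>x y. norm (g x - g y) = norm (f x - f y)"
    using hilbert_map_realised_in_ell2[of f] by blast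
  then show ?thesis
    unfolding compression_exponent_def using assms
    by (intro conjI exI[of _ g] exI[of _ C] exI[of _ C'] exI[of _ D] exI[of _ D']) simp_all
qed

text \<open>The supremum is taken over a nonempty bounded set, so it is never a default value.\<close>

lemma compression_exponent_0: "compression_exponent X d 0"
  if "\<And>x y. x \<in> X \<Longrightarrow> y \<in> X \<Longrightarrow> d x y \<ge> 0"
  by (rule compression_exponentI[where f = "\<lambda>_. 0 :: real" and C = 1 and C' = 1 and D = 0 and D' = 1])
    (use that in auto)

lemma bdd_above_compression_exponent: "bdd_above {\<delta>. compression_exponent X d \<delta>}"
  by (rule bdd_aboveI[of _ 1]) (auto simp: compression_exponent_def)


section \<open>Word lengths and hyperbolic groups\<close>

definition finite_symmetric_generating_set :: "('a, 'b) monoid_scheme \<Rightarrow> 'a set \<Rightarrow> bool"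
  where "finite_symmetric_generating_set G S \<longleftrightarrow>
    finite S \<and> S \<subseteq> carrier G \<and> (\<forall>s\<in>S. inv\<^bsub>G\<^esub> s \<in> S) \<and> generate G S = carrier G"

text \<open>Inverses of letters need not be allowed in words, because \<open>S\<close> is always symmetric.\<close>

definition word_length :: "('a, 'b) monoid_scheme \<Rightarrow> 'a set \<Rightarrow> 'a \<Rightarrow> real"
  where "word_length G S x =
    real (LEAST n. \<exists>ws. length ws = n \<and> set ws \<subseteq> S \<and> foldr (\<otimes>\<^bsub>G\<^esub>) ws \<one>\<^bsub>G\<^esub> = x)"

definition length_metric :: "('a, 'b) monoid_scheme \<Rightarrow> ('a \<Rightarrow> real) \<Rightarrow> 'a \<Rightarrow> 'a \<Rightarrow> real"
  where "length_metric G l x y = l (inv\<^bsub>G\<^esub> x \<otimes>\<^bsub>G\<^esub> y)"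

definition gromov_product :: "('a \<Rightarrow> 'a \<Rightarrow> real) \<Rightarrow> 'a \<Rightarrow> 'a \<Rightarrow> 'a \<Rightarrow> real"
  where "gromov_product d w x y = (d w x + d w y - d x y) / 2"

definition gromov_hyperbolic :: "'a set \<Rightarrow> ('a \<Rightarrow> 'a \<Rightarrow> real) \<Rightarrow> bool"
  where "gromov_hyperbolic X d \<longleftrightarrow> (\<exists>\<delta>\<ge>0. \<forall>w\<in>X. \<forall>x\<in>X. \<forall>y\<in>X. \<forall>z\<in>X.
    gromov_product d w x z \<ge> min (gromov_product d w x y) (gromov_product d w y z) - \<delta>)"

text \<open>
  Hyperbolicity of a finitely generated group does not depend on the generating set; the
  definition asks for one finite symmetric generating set whose word metric is hyperbolic.
\<close>

definition hyperbolic_group :: "('a, 'b) monoid_scheme \<Rightarrow> bool"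
  where "hyperbolic_group G \<longleftrightarrow> group G \<and>
    (\<exists>T. finite_symmetric_generating_set G T \<and>
         gromov_hyperbolic (carrier G) (length_metric G (word_length G T)))"

end

theory Submission
  imports Defs
begin

text \<open>
  Over a hyperbolic group \<open>G\<close>, points can be spread out into unit vectors of finite support that vary
  very slowly. Follow the geodesics from all points within distance \<open>k\<close> of \<open>x\<close> towards the identity for
  a fixed length \<open>l \<ge> k\<close>. The set of points reached, the fan, is contained in the next larger fan of
  each neighbour of \<open>x\<close>. By hyperbolicity the points of a fan at a given distance from the identity lie in
  a ball of bounded size, so a fan has only \<open>O(k)\<close> points (\<open>fan_finite_card\<close>). The normalised
  indicators of the fans for \<open>k = 1, \<dots>, n\<close>, each in its own copy of \<open>\<ell>\<^sup>2\<close> and divided by \<open>sqrt n\<close>, form a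
  unit vector supported at distance \<open>O(n)\<close> from \<open>x\<close>. In the estimate of its variation the logarithms of
  the sizes of the fans telescope, so for neighbouring points the squared distance is \<open>O(ln n / n)\<close> (\<open>sum_fan_weight_diff_squared\<close>).

  These weights glue a map \<open>f\<close> from \<open>H\<close> to a Hilbert space to a map on \<open>\<Gamma>\<close>. If \<open>p \<in> G\<close> is at distance
  \<open>O(n)\<close> from \<open>\<pi> x\<close>, then \<open>x\<close> can be moved to the fibre over \<open>p\<close>, a copy of \<open>H\<close>, at a cost of \<open>O(n)\<close>, and \<open>f\<close>
  can be applied there. Since the values of \<open>f\<close> are unbounded, they are first shrunk by a factor \<open>s\<close> and
  turned into unit vectors by a map that has the Gaussian kernel as inner product
  (\<open>gaussian_kernel_map\<close>). The result (\<open>map_at_one_scale\<close>) has squared variation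
  \<open>O(ln n / n + (n / s)\<^sup>2)\<close>, and it keeps points apart whose distance \<open>D\<close> satisfies \<open>D powr \<beta> \<ge> B * s\<close> for a
  suitable constant \<open>B\<close>, where \<open>\<beta>\<close> is a compression exponent of \<open>f\<close>.

  Finally the maps for \<open>n = 2 ^ (10 * j)\<close> and \<open>s = 2 ^ (15 * j)\<close> are summed with weights \<open>2 ^ (3 * j)\<close>. The
  variations remain square-summable, so the sum is Lipschitz, and the last scale that separates two
  points shows that they are mapped to distance at least of order \<open>(D powr \<beta>) powr (3 / 15)\<close>
  (\<open>compression_exponent_over_hyperbolic\<close>). Each compression exponent \<open>\<beta>\<close> of \<open>H\<close> thus yields the exponent
  \<open>\<beta> / 5\<close> for \<open>\<Gamma>\<close> (\<open>compression_exponent_extension\<close>), and the theorem follows by taking suprema.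
\<close>

section \<open>Hilbert sums and the Gaussian kernel\<close>

text \<open>
  The Hilbert sum of copies of one \<open>\<ell>\<^sup>2\<close> space is again a space of square-summable families,
  now indexed by pairs, so no new type of vectors is needed.
\<close>

lemma norm_diff_hilbert_sum:
  fixes v w :: "'b \<Rightarrow> 'c ell2"
  defines "hsum \<equiv> \<lambda>v :: 'b \<Rightarrow> 'c ell2. Abs_ell2 (\<lambda>(b, c). ell2_coord (v b) c)"
  assumes v: "(\<lambda>b. (norm (v b))\<^sup>2) summable_on UNIV"
    and w: "(\<lambda>b. (norm (w b))\<^sup>2) summable_on UNIV"
  shows "((\<lambda>b. (norm (v b - w b))\<^sup>2) has_sum (norm (hsum v - hsum w))\<^sup>2) UNIV"
proof -
  have coord: "((\<lambda>c. (ell2_coord x c)\<^sup>2) has_sum (norm x)\<^sup>2) UNIV" for x :: "'c ell2"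
    unfolding norm_ell2_sq by (rule has_sum_infsum[OF ell2_coord_summable])
  have summ: "(\<lambda>i. ((\<lambda>(b, c). ell2_coord (v b) c) i)\<^sup>2) summable_on UNIV"
    if "(\<lambda>b. (norm (v b))\<^sup>2) summable_on UNIV" for v :: "'b \<Rightarrow> 'c ell2"
    using summable_on_SigmaI[where A = UNIV and B = "\<lambda>_. UNIV"
        and f = "\<lambda>i. ((\<lambda>(b, c). ell2_coord (v b) c) i)\<^sup>2", OF _ that]
    by (simp add: coord)
  have hsum: "ell2_coord (hsum v) i = (case i of (b, c) \<Rightarrow> ell2_coord (v b) c)"
    if "(\<lambda>b. (norm (v b))\<^sup>2) summable_on UNIV" for v :: "'b \<Rightarrow> 'c ell2" and i
    unfolding hsum_def using summ[OF that] by (subst Abs_ell2_inverse) auto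
  have "((\<lambda>i. (ell2_coord (hsum v - hsum w) i)\<^sup>2) has_sum (norm (hsum v - hsum w))\<^sup>2) (UNIV \<times> UNIV)"
    using has_sum_infsum[OF ell2_coord_summable, of "hsum v - hsum w"]
    by (simp add: norm_ell2_sq)
  then have "((\<lambda>(b, c). (ell2_coord (v b - w b) c)\<^sup>2) has_sum (norm (hsum v - hsum w))\<^sup>2) (UNIV \<times> UNIV)"
    by (simp add: minus_ell2.rep_eq hsum[OF v] hsum[OF w] case_prod_unfold)
  from has_sum_SigmaD[OF this] show ?thesis
    using coord by auto
qed

text \<open>
  Subtracting the value at a base point lets maps be summed whose values are not square-summable
  themselves: only their differences have to be. This is what makes it possible to add up
  infinitely many scales with growing weights.
\<close>

lemma hilbert_sum_of_maps:
  fixes f :: "'j \<Rightarrow> 'x \<Rightarrow> 'c ell2"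
  assumes "\<And>x y. x \<in> X \<Longrightarrow> y \<in> X \<Longrightarrow> (\<lambda>j. (norm (f j x - f j y))\<^sup>2) summable_on UNIV"
  shows "\<exists>\<Phi> :: 'x \<Rightarrow> ('j \<times> 'c) ell2. \<forall>x\<in>X. \<forall>y\<in>X.
    ((\<lambda>j. (norm (f j x - f j y))\<^sup>2) has_sum (norm (\<Phi> x - \<Phi> y))\<^sup>2) UNIV"
proof (cases "X = {}")
  case False
  then obtain o' where "o' \<in> X" by blast
  with norm_diff_hilbert_sum[OF assms assms, of _ o' _ o'] show ?thesis
    by (intro exI[of _ "\<lambda>x. Abs_ell2 (\<lambda>(j, c). ell2_coord (f j x - f j o') c)"]) simp
qed simp

text \<open>
  Expanding \<open>(\<Sum>i. g i) ^ n\<close> gives one monomial for each word of length \<open>n\<close>. Absolute summability is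
  carried through the induction because it is what allows the sum over words to be taken letter by
  letter.
\<close>

lemma prod_list_words_has_sum:
  fixes g :: "'i \<Rightarrow> real"
  assumes abs: "(\<lambda>i. norm (g i)) summable_on UNIV" and g: "(g has_sum s) UNIV"
  shows "(\<lambda>ws. norm (prod_list (map g ws))) summable_on {ws. length ws = n}"
    and "((\<lambda>ws. prod_list (map g ws)) has_sum s ^ n) {ws. length ws = n}"
proof (induction n)
  case 0
  have *: "{ws :: 'i list. length ws = 0} = {[]}" by auto
  { case 1 show ?case unfolding * by simp }
  { case 2 show ?case unfolding * by (rule has_sum_finiteI) auto }
next
  case (Suc n)
  let ?p = "\<lambda>ws. prod_list (map g ws)" and ?W = "\<lambda>n. {ws :: 'i list. length ws = n}"
  have bij: "bij_betw (\<lambda>(i, ws). i # ws) (UNIV \<times> ?W n) (?W (Suc n))"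
    by (rule bij_betwI[of _ _ _ "\<lambda>ws. (hd ws, tl ws)"]) (auto simp: length_Suc_conv)
  have abs': "(\<lambda>x. norm ((\<lambda>(i, ws). g i * ?p ws) x)) summable_on (UNIV \<times> ?W n)"
    unfolding Infinite_Sum.abs_summable_on_Sigma_iff
    using summable_on_cmult_right[OF Suc(1)]
      summable_on_cmult_left[OF abs, of "infsum (\<lambda>ws. norm (?p ws)) (?W n)"]
    by (simp add: abs_mult infsum_cmult_right' infsum_nonneg)
  { case 1
    show ?case
      using abs' summable_on_reindex_bij_betw[OF bij, of "\<lambda>ws. norm (?p ws)"]
      by (simp add: case_prod_unfold) }
  { case 2
    have "((\<lambda>(i, ws). g i * ?p ws) has_sum s ^ Suc n) (UNIV \<times> ?W n)"
    proof (rule has_sum_SigmaI)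
      show "((\<lambda>ws. (\<lambda>(i, ws). g i * ?p ws) (i, ws)) has_sum g i * s ^ n) (?W n)" for i
        using has_sum_cmult_right[OF Suc(2)] by simp
      show "((\<lambda>i. g i * s ^ n) has_sum s ^ Suc n) UNIV"
        using has_sum_cmult_left[OF g] by simp
      show "(\<lambda>(i, ws). g i * ?p ws) summable_on (UNIV \<times> ?W n)"
        by (rule abs_summable_summable[OF abs'])
    qed
    then show ?case
      using has_sum_reindex_bij_betw[OF bij, of ?p] by (simp add: case_prod_unfold) }
qed

lemma prod_list_over_fact_has_sum_exp:
  fixes g :: "'i \<Rightarrow> real"
  assumes abs: "(\<lambda>i. norm (g i)) summable_on UNIV" and g: "(g has_sum s) UNIV"
  shows "((\<lambda>ws. prod_list (map g ws) / fact (length ws)) has_sum exp s) UNIV"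
proof -
  let ?W = "\<lambda>n. {ws :: 'i list. length ws = n}"
  have bij: "bij_betw snd (Sigma UNIV ?W) UNIV"
    by (rule bij_betwI[of _ _ _ "\<lambda>ws. (length ws, ws)"]) auto
  have exp: "((\<lambda>n. t ^ n / fact n) has_sum exp t) UNIV" for t :: real
    using norm_summable_imp_has_sum[OF summable_norm_exp exp_converges, of t]
    by (simp add: field_simps)
  have abs': "(\<lambda>i. norm \<bar>g i\<bar>) summable_on UNIV"
    using abs by simp
  have "((\<lambda>i. \<bar>g i\<bar>) has_sum infsum (\<lambda>i. \<bar>g i\<bar>) UNIV) UNIV"
    using abs by (intro has_sum_infsum) simp
  note abs_words = prod_list_words_has_sum(2)[OF abs' this]
  have pabs: "\<bar>prod_list (map g ws)\<bar> = prod_list (map (\<lambda>i. \<bar>g i\<bar>) ws)" for ws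
    by (induction ws) (auto simp: abs_mult)
  have abs_summ: "(\<lambda>(n, ws). \<bar>prod_list (map g ws)\<bar> / fact n) summable_on Sigma UNIV ?W"
  proof (rule summable_on_SigmaI)
    show "((\<lambda>ws. (\<lambda>(n, ws). \<bar>prod_list (map g ws)\<bar> / fact n) (n, ws)) has_sum
        infsum (\<lambda>i. \<bar>g i\<bar>) UNIV ^ n / fact n) (?W n)" for n
      using has_sum_divide_const[OF abs_words] by (simp add: pabs)
    show "(\<lambda>n. infsum (\<lambda>i. \<bar>g i\<bar>) UNIV ^ n / fact n) summable_on UNIV"
      by (rule has_sum_imp_summable[OF exp])
  qed auto
  have summ: "(\<lambda>(n, ws). prod_list (map g ws) / fact n) summable_on Sigma UNIV ?W"
    by (rule abs_summable_summable) (use abs_summ in \<open>simp add: case_prod_unfold\<close>)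
  have "((\<lambda>(n, ws). prod_list (map g ws) / fact n) has_sum exp s) (Sigma UNIV ?W)"
    by (rule has_sum_SigmaI[OF _ exp summ])
      (use has_sum_divide_const[OF prod_list_words_has_sum(2)[OF abs g]] in simp)
  also have "?this \<longleftrightarrow> ((\<lambda>x. prod_list (map g (snd x)) / fact (length (snd x))) has_sum exp s) (Sigma UNIV ?W)"
    by (rule has_sum_cong) auto
  also have "\<dots> \<longleftrightarrow> ?thesis"
    by (rule has_sum_reindex_bij_betw[OF bij, of "\<lambda>ws. prod_list (map g ws) / fact (length ws)"])
  finally show ?thesis .
qed

text \<open>
  The Gaussian kernel is the inner product of unit vectors in Fock space: the coordinates of \<open>E u\<close>
  are indexed by words, and those at words of length \<open>n\<close> form \<open>u \<otimes> \<dots> \<otimes> u / sqrt (fact n)\<close> up to a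
  scalar. Hence \<open>\<langle>E u, E v\<rangle>\<close> is \<open>exp \<langle>u, v\<rangle>\<close> times the two normalising factors. The map \<open>E\<close> does not
  increase distances, keeps points at distance at least \<open>1\<close> uniformly apart, and takes values of
  norm \<open>1\<close>, however large the argument is.
\<close>

lemma gaussian_kernel_map:
  "\<exists>E :: 'i ell2 \<Rightarrow> 'i list ell2. \<forall>u v. inner (E u) (E v) = exp (- (norm (u - v))\<^sup>2 / 2)"
proof -
  define e :: "'i ell2 \<Rightarrow> 'i list \<Rightarrow> real"
    where "e u ws = exp (- (norm u)\<^sup>2 / 2) * (prod_list (map (ell2_coord u) ws) / sqrt (fact (length ws)))" for u ws
  have mult: "e u ws * e v ws = exp (- (norm u)\<^sup>2 / 2 - (norm v)\<^sup>2 / 2) *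
      (prod_list (map (\<lambda>i. ell2_coord u i * ell2_coord v i) ws) / fact (length ws))" for u v ws
  proof -
    have "prod_list (map (\<lambda>i. ell2_coord u i * ell2_coord v i) ws)
        = prod_list (map (ell2_coord u) ws) * prod_list (map (ell2_coord v) ws)"
      by (induction ws) auto
    moreover have "exp (- (norm u)\<^sup>2 / 2 - (norm v)\<^sup>2 / 2) = exp (- (norm u)\<^sup>2 / 2) * exp (- (norm v)\<^sup>2 / 2)"
      by (simp flip: exp_add)
    ultimately show ?thesis
      by (simp add: e_def)
  qed
  have "((\<lambda>ws. e u ws * e v ws) has_sum exp (- (norm (u - v))\<^sup>2 / 2)) UNIV" for u v
  proof -
    have "(\<lambda>i. norm (ell2_coord u i * ell2_coord v i)) summable_on UNIV"
      by (rule abs_summable_product) (use ell2_coord_summable[of u] ell2_coord_summable[of v] in \<open>simp_all add: power2_eq_square\<close>)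
    moreover from abs_summable_summable[OF this] have "((\<lambda>i. ell2_coord u i * ell2_coord v i) has_sum inner u v) UNIV"
      by (simp add: inner_ell2.rep_eq)
    ultimately have "((\<lambda>ws. e u ws * e v ws) has_sum exp (- (norm u)\<^sup>2 / 2 - (norm v)\<^sup>2 / 2) * exp (inner u v)) UNIV"
      unfolding mult by (intro has_sum_cmult_right prod_list_over_fact_has_sum_exp)
    moreover have "- (norm u)\<^sup>2 / 2 - (norm v)\<^sup>2 / 2 + inner u v = - (norm (u - v))\<^sup>2 / 2"
      by (simp add: power2_norm_eq_inner inner_diff_left inner_diff_right inner_commute field_simps)
    ultimately show ?thesis
      by (simp flip: exp_add)
  qed
  note has_sum = this
  have coord: "ell2_coord (Abs_ell2 (e u)) = e u" for u
    by (rule Abs_ell2_inverse) (use has_sum_imp_summable[OF has_sum[of u u]] in \<open>simp add: power2_eq_square\<close>)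
  show ?thesis
    by (intro exI[of _ "\<lambda>u. Abs_ell2 (e u)"] allI)
      (simp add: inner_ell2.rep_eq coord infsumI[OF has_sum])
qed

section \<open>Fans of geodesics in hyperbolic graphs\<close>

text \<open>
  The vertex set of a connected graph with its path metric. Word metrics are of this kind. The last
  axiom replaces geodesics: it provides the point at each integer distance along one.
\<close>

locale graph_metric =
  fixes X :: "'x set" and d :: "'x \<Rightarrow> 'x \<Rightarrow> real"
  assumes dist_Nats: "x \<in> X \<Longrightarrow> y \<in> X \<Longrightarrow> d x y \<in> \<nat>"
    and dist_eq_0: "x \<in> X \<Longrightarrow> y \<in> X \<Longrightarrow> d x y = 0 \<longleftrightarrow> x = y"
    and dist_sym: "x \<in> X \<Longrightarrow> y \<in> X \<Longrightarrow> d x y = d y x"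
    and dist_triangle: "x \<in> X \<Longrightarrow> y \<in> X \<Longrightarrow> z \<in> X \<Longrightarrow> d x z \<le> d x y + d y z"
    and geodesic_point: "x \<in> X \<Longrightarrow> y \<in> X \<Longrightarrow> real m \<le> d x y \<Longrightarrow>
      \<exists>z\<in>X. d x z = real m \<and> d z y = d x y - real m"
begin

lemma dist_nonneg: "x \<in> X \<Longrightarrow> y \<in> X \<Longrightarrow> d x y \<ge> 0"
  using dist_Nats[of x y] by (auto simp: Nats_def)

lemma lipschitz_of_adjacent:
  fixes f :: "'x \<Rightarrow> 'v :: real_normed_vector"
  assumes adj: "\<And>x y. x \<in> X \<Longrightarrow> y \<in> X \<Longrightarrow> d x y \<le> 1 \<Longrightarrow> norm (f x - f y) \<le> e"
    and "x \<in> X" "y \<in> X"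
  shows "norm (f x - f y) \<le> e * d x y"
proof -
  obtain m where "d x y = real m"
    using dist_Nats[OF assms(2,3)] by (auto elim: Nats_cases)
  then show ?thesis using assms(2,3)
  proof (induction m arbitrary: y)
    case 0
    then show ?case using dist_eq_0[of x y] dist_eq_0[of y y] by auto
  next
    case (Suc m)
    obtain z where z: "z \<in> X" "d x z = real m" "d z y = 1"
      using geodesic_point[OF Suc.prems(2,3), of m] Suc.prems(1) by auto
    have "norm (f x - f y) \<le> norm (f x - f z) + norm (f z - f y)"
      by (rule norm_diff_triangle_le) auto
    also have "\<dots> \<le> e * real m + e"
      using Suc.IH[OF z(2) Suc.prems(2) z(1)] adj[OF z(1) Suc.prems(3)] z by simp
    finally show ?case using Suc.prems(1) by (simp add: algebra_simps)
  qed
qed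

end

text \<open>
  Bounded geometry is only asked for balls of radius \<open>4 * e\<close>, since this is the size to
  which hyperbolicity confines the points that have to be counted.
\<close>

locale hyperbolic_graph_metric = graph_metric +
  fixes e :: real and N :: nat and o' :: 'a
  assumes basepoint: "o' \<in> X"
    and hyp_nonneg: "e \<ge> 0"
    and hyperbolic: "w \<in> X \<Longrightarrow> x \<in> X \<Longrightarrow> y \<in> X \<Longrightarrow> z \<in> X \<Longrightarrow>
      gromov_product d w x z \<ge> min (gromov_product d w x y) (gromov_product d w y z) - e"
    and finite_ball: "x \<in> X \<Longrightarrow> finite {y \<in> X. d x y \<le> 4 * e}"
    and card_ball_le: "x \<in> X \<Longrightarrow> card {y \<in> X. d x y \<le> 4 * e} \<le> N"
begin

text \<open>
  All geodesics that start within distance \<open>r\<close> of \<open>x\<close> are followed towards the base point for length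
  \<open>l\<close>, or up to the base point if it is closer. The fan consists of the points reached. It grows with \<open>r\<close>,
  and moving \<open>x\<close> costs no more than enlarging \<open>r\<close> by the distance moved; hyperbolicity makes it
  small, because geodesics with a common end point merge.
\<close>

definition fan :: "nat \<Rightarrow> nat \<Rightarrow> 'a \<Rightarrow> 'a set" where
  "fan l r x = {p \<in> X. \<exists>y\<in>X. d x y \<le> real r \<and> d y p = min (real l) (d y o') \<and> d y p + d p o' = d y o'}"

lemma fan_subset: "fan l r x \<subseteq> X"
  by (auto simp: fan_def)

lemma fan_nonempty: "x \<in> X \<Longrightarrow> fan l r x \<noteq> {}"
proof -
  assume x: "x \<in> X"
  obtain m where m: "d x o' = real m"
    using dist_Nats[OF x basepoint] by (auto elim: Nats_cases)
  obtain p where "p \<in> X" "d x p = real (min l m)" "d p o' = d x o' - real (min l m)"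
    using geodesic_point[OF x basepoint, of "min l m"] m by auto
  then have "p \<in> fan l r x"
    unfolding fan_def using x m dist_eq_0[OF x x] by (auto intro!: bexI[of _ x])
  then show ?thesis by blast
qed

lemma fan_mono:
  assumes "x \<in> X" "x' \<in> X" "d x x' \<le> real s" "r + s \<le> r'"
  shows "fan l r x \<subseteq> fan l r' x'"
proof
  fix p assume "p \<in> fan l r x"
  then obtain y where y: "p \<in> X" "y \<in> X" "d x y \<le> real r" "d y p = min (real l) (d y o')"
      "d y p + d p o' = d y o'"
    by (auto simp: fan_def)
  have "d x' y \<le> real r'"
    using dist_triangle[of x' x y] dist_sym[of x x'] assms y by auto
  then show "p \<in> fan l r' x'" using y by (auto simp: fan_def)
qed

lemma dist_fan_le:
  assumes "x \<in> X" "p \<in> fan l r x"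
  shows "d x p \<le> real (r + l)"
proof -
  obtain y where "p \<in> X" "y \<in> X" "d x y \<le> real r" "d y p = min (real l) (d y o')"
    using assms by (auto simp: fan_def)
  then show ?thesis using dist_triangle[of x y p] assms by auto
qed

text \<open>
  Let \<open>m > 0\<close> be the common distance of \<open>p\<close> and \<open>p'\<close> from the base point. The geodesics through \<open>p\<close> and
  \<open>p'\<close> start at points \<open>y\<close> and \<open>y'\<close> at distance \<open>m + l\<close> from the base point and at most \<open>2 * l\<close> from each
  other. So the Gromov products of neighbours in the chain \<open>p, y, y', p'\<close> are at least \<open>m\<close>, and two applications
  of hyperbolicity give \<open>m - 2 * e\<close> for the Gromov product of \<open>p\<close> and \<open>p'\<close>.
\<close>

lemma fan_level_close:
  assumes x: "x \<in> X" and "r \<le> l" and p: "p \<in> fan l r x" and p': "p' \<in> fan l r x"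
    and eq: "d p o' = d p' o'"
  shows "d p p' \<le> 4 * e"
proof (cases "d p o' = 0")
  case True
  then have "p = o'" "p' = o'"
    using p p' eq dist_eq_0 basepoint fan_subset by (metis subsetD)+
  then show ?thesis using dist_eq_0[OF basepoint basepoint] hyp_nonneg by simp
next
  case False
  obtain y where y: "p \<in> X" "y \<in> X" "d x y \<le> real r" "d y p = min (real l) (d y o')"
      "d y p + d p o' = d y o'"
    using p by (auto simp: fan_def)
  obtain y' where y': "p' \<in> X" "y' \<in> X" "d x y' \<le> real r" "d y' p' = min (real l) (d y' o')"
      "d y' p' + d p' o' = d y' o'"
    using p' by (auto simp: fan_def)
  have l: "d y p = real l" "d y' p' = real l"
    using y y' False eq by (auto simp: min_def split: if_splits)
  note sym = dist_sym[OF basepoint y(1)] dist_sym[OF basepoint y(2)]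
    dist_sym[OF basepoint y'(1)] dist_sym[OF basepoint y'(2)] dist_sym[OF y(1,2)] dist_sym[OF y'(1,2)]
  have 1: "gromov_product d o' p y = d p o'"
    using y(5) sym by (simp add: gromov_product_def)
  have 2: "gromov_product d o' y' p' = d p o'"
    using y'(5) sym eq by (simp add: gromov_product_def)
  have "d y y' \<le> 2 * real l"
    using dist_triangle[OF y(2) x y'(2)] dist_sym[OF x y(2)] y(3) y'(3) \<open>r \<le> l\<close> by linarith
  then have 3: "gromov_product d o' y y' \<ge> d p o'"
    using y(5) y'(5) l sym eq by (simp add: gromov_product_def)
  have "gromov_product d o' y p' \<ge> d p o' - e"
    using hyperbolic[OF basepoint y(2) y'(2) y'(1)] 2 3 by simp
  then have "gromov_product d o' p p' \<ge> d p o' - 2 * e"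
    using hyperbolic[OF basepoint y(1) y(2) y'(1)] 1 hyp_nonneg by (simp add: min_def split: if_splits)
  then show ?thesis
    using sym eq by (simp add: gromov_product_def)
qed

text \<open>
  A level of the fan lies in one ball of radius \<open>4 * e\<close>. Apart from level \<open>0\<close>, where a geodesic has
  ended in the base point, the level is \<open>d y o' - l\<close> for a starting point \<open>y\<close>, which leaves \<open>2 * r + 1\<close> values.
\<close>

lemma fan_finite_card:
  assumes x: "x \<in> X" and "r \<le> l"
  shows "finite (fan l r x)" "card (fan l r x) \<le> N * (2 * r + 2)"
proof -
  define I :: "real set" where
    "I = insert 0 ((\<lambda>i. d x o' - real l - real r + real i) ` {..2 * r})"
  define level where "level m = {p \<in> fan l r x. d p o' = m}" for m
  have level: "finite (level m) \<and> card (level m) \<le> N" for m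
  proof (cases "level m = {}")
    case False
    then obtain p where p: "p \<in> fan l r x" "d p o' = m" by (auto simp: level_def)
    then have "level m \<subseteq> {p' \<in> X. d p p' \<le> 4 * e}"
      using fan_level_close[OF assms p(1)] by (auto simp: level_def dest: subsetD[OF fan_subset])
    moreover have "p \<in> X" using p fan_subset by blast
    ultimately show ?thesis
      using finite_subset[OF _ finite_ball[of p]] card_mono[OF finite_ball[of p], of "level m"]
        card_ball_le[of p] by auto
  qed simp
  have "d p o' \<in> I" if p: "p \<in> fan l r x" for p
  proof -
    obtain y where y: "p \<in> X" "y \<in> X" "d x y \<le> real r" "d y p = min (real l) (d y o')"
        "d y p + d p o' = d y o'"
      using p unfolding fan_def by blast
    show ?thesis
    proof (cases "d p o' = 0")
      case False
      then have l: "d y p = real l"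
        using y by (auto simp: min_def split: if_splits)
      obtain a b where ab: "d x o' = real a" "d y o' = real b"
        using dist_Nats basepoint x y(2) by (metis Nats_cases)
      have "\<bar>real a - real b\<bar> \<le> real r"
        using dist_triangle[OF x y(2) basepoint] dist_triangle[OF y(2) x basepoint]
          dist_sym[OF x y(2)] y(3) ab by auto
      then have ab': "a \<le> b + r" "b \<le> a + r" by linarith+
      then have "d p o' = d x o' - real l - real r + real (b + r - a)"
        using y(5) l ab by (simp add: of_nat_diff)
      moreover have "b + r - a \<in> {..2 * r}" using ab' by simp
      ultimately show ?thesis unfolding I_def by blast
    qed (simp add: I_def)
  qed
  then have fan: "fan l r x = (\<Union>m\<in>I. level m)"
    by (auto simp: level_def)
  have I: "finite I" "card I \<le> 2 * r + 2"
    unfolding I_def by (auto intro!: card_insert_le_m1 order_trans[OF card_image_le])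
  show "finite (fan l r x)"
    unfolding fan using I level by blast
  have "card (fan l r x) \<le> (\<Sum>m\<in>I. card (level m))"
    unfolding fan by (rule card_UN_le[OF I(1)])
  also have "\<dots> \<le> card I * N"
    using sum_bounded_above[of I "\<lambda>m. card (level m)" N] level by simp
  also have "\<dots> \<le> N * (2 * r + 2)" unfolding mult.commute[of N] by (rule mult_le_mono1[OF I(2)])
  finally show "card (fan l r x) \<le> N * (2 * r + 2)" .
qed

end

section \<open>Slowly varying weights and the map at one scale\<close>

text \<open>
  The square is the average over \<open>k\<close> of the uniform probability distributions on the sets \<open>S k\<close>,
  with the different values of \<open>k\<close> kept apart. Thus the weights form a unit vector.
\<close>

definition fan_weight :: "nat \<Rightarrow> (nat \<Rightarrow> 'p set) \<Rightarrow> nat \<times> 'p \<Rightarrow> real" where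
  "fan_weight n S = (\<lambda>(k, p). if k \<in> {1..n} \<and> p \<in> S k then 1 / sqrt (real n * real (card (S k))) else 0)"

lemma sum_fan_weight_mult:
  assumes "finite D" "Sigma {1..n} (\<lambda>k. S k \<inter> T k) \<subseteq> D"
    and fin: "\<And>k. k \<in> {1..n} \<Longrightarrow> finite (S k)"
  shows "(\<Sum>b\<in>D. fan_weight n S b * fan_weight n T b) =
    (\<Sum>k=1..n. card (S k \<inter> T k) / sqrt (real (card (S k)) * real (card (T k)))) / n"
proof -
  have "(\<Sum>b\<in>D. fan_weight n S b * fan_weight n T b) =
      (\<Sum>b\<in>Sigma {1..n} (\<lambda>k. S k \<inter> T k). fan_weight n S b * fan_weight n T b)"
    by (rule sum.mono_neutral_right) (use assms in \<open>auto simp: fan_weight_def split: if_splits\<close>)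
  also have "\<dots> = (\<Sum>k=1..n. \<Sum>p\<in>S k \<inter> T k. fan_weight n S (k, p) * fan_weight n T (k, p))"
    by (subst sum.Sigma) (use fin in auto)
  also have "\<dots> = (\<Sum>k=1..n. card (S k \<inter> T k) / sqrt (real (card (S k)) * real (card (T k))) / n)"
  proof (rule sum.cong)
    fix k assume k: "k \<in> {1..n}"
    have "(\<Sum>p\<in>S k \<inter> T k. fan_weight n S (k, p) * fan_weight n T (k, p)) =
        (\<Sum>p\<in>S k \<inter> T k. 1 / sqrt (real (card (S k)) * real (card (T k))) / n)"
      by (rule sum.cong) (use k in \<open>auto simp: fan_weight_def real_sqrt_mult\<close>)
    then show "(\<Sum>p\<in>S k \<inter> T k. fan_weight n S (k, p) * fan_weight n T (k, p)) =
        card (S k \<inter> T k) / sqrt (real (card (S k)) * real (card (T k))) / n"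
      by simp
  qed simp
  finally show ?thesis by (simp add: sum_divide_distrib)
qed

lemma sum_fan_weight_squared:
  assumes "finite D" "Sigma {1..n} S \<subseteq> D" "n \<ge> 1"
    and S: "\<And>k. k \<in> {1..n} \<Longrightarrow> finite (S k) \<and> S k \<noteq> {}"
  shows "(\<Sum>b\<in>D. (fan_weight n S b)\<^sup>2) = 1"
proof -
  have "(\<Sum>b\<in>D. (fan_weight n S b)\<^sup>2) = (\<Sum>k=1..n. card (S k) / sqrt (real (card (S k)) * real (card (S k)))) / n"
    using sum_fan_weight_mult[of D n S S] assms by (simp add: power2_eq_square)
  also have "(\<Sum>k=1..n. card (S k) / sqrt (real (card (S k)) * real (card (S k)))) = (\<Sum>k=1..n. 1)"
    by (rule sum.cong) (use S in auto)
  finally show ?thesis using \<open>n \<ge> 1\<close> by simp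
qed

text \<open>
  Averaging over a range of radii turns slow growth into small variation. Both \<open>S k\<close> and \<open>T k\<close>
  contain \<open>S (k - 1)\<close> and are contained in \<open>S (k + 1)\<close>, so their normalised indicators overlap by at least
  \<open>card (S (k - 1)) / card (S (k + 1))\<close>. This is at least \<open>1\<close> plus its logarithm, and the
  logarithms telescope in the sum over \<open>k\<close>.
\<close>

lemma sum_fan_weight_diff_squared:
  fixes S T :: "nat \<Rightarrow> 'p set"
  assumes D: "finite D" "Sigma {1..n} S \<subseteq> D" "Sigma {1..n} T \<subseteq> D" and n: "n \<ge> 1"
    and S: "\<And>k. k \<le> n + 1 \<Longrightarrow> finite (S k) \<and> S k \<noteq> {} \<and> card (S k) \<le> P"
    and T: "\<And>k. k \<le> n + 1 \<Longrightarrow> finite (T k) \<and> T k \<noteq> {}"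
    and mono: "\<And>k. k \<le> n \<Longrightarrow> S k \<subseteq> S (k + 1)"
    and nested: "\<And>k. k \<le> n \<Longrightarrow> S k \<subseteq> T (k + 1)" "\<And>k. k \<le> n \<Longrightarrow> T k \<subseteq> S (k + 1)"
  shows "(\<Sum>b\<in>D. (fan_weight n S b - fan_weight n T b)\<^sup>2) \<le> 4 * ln P / n"
proof -
  define s where "s k = real (card (S k))" for k
  have s: "1 \<le> s k" "s k \<le> P" if "k \<le> n + 1" for k
    using S[OF that] by (auto simp: s_def Suc_le_eq card_gt_0_iff)
  define q where "q k = card (S k \<inter> T k) / sqrt (real (card (S k)) * real (card (T k)))" for k
  have q: "1 + ln (s (k - 1)) - ln (s (k + 1)) \<le> q k" if k: "k \<in> {1..n}" for k
  proof -
    have k': "k - 1 \<le> n" "k - 1 + 1 = k" "k \<le> n" "k - 1 \<le> n + 1" "k \<le> n + 1" "k + 1 \<le> n + 1" using k by auto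
    have "S (k - 1) \<subseteq> S k \<inter> T k"
      using mono[OF k'(1)] nested(1)[OF k'(1)] unfolding k'(2) by blast
    then have 1: "s (k - 1) \<le> card (S k \<inter> T k)"
      using S[OF k'(5)] by (auto simp: s_def intro!: card_mono)
    have 2: "real (card (S k)) \<le> s (k + 1)" "real (card (T k)) \<le> s (k + 1)"
      using mono[OF k'(3)] nested(2)[OF k'(3)] S[OF k'(6)] by (auto simp: s_def intro!: card_mono)
    have pos: "card (S k) > 0" "card (T k) > 0"
      using S[OF k'(5)] T[OF k'(5)] by (auto simp: card_gt_0_iff)
    have "sqrt (real (card (S k)) * real (card (T k))) \<le> sqrt (s (k + 1) * s (k + 1))"
      using 2 by (intro real_sqrt_le_mono mult_mono) (auto simp: s_def)
    also have "\<dots> = s (k + 1)" by (simp add: s_def)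
    finally have 3: "s (k - 1) / s (k + 1) \<le> q k"
      unfolding q_def using 1 pos s[OF k'(4)] by (intro frac_le) auto
    have "ln (s (k - 1) / s (k + 1)) \<le> s (k - 1) / s (k + 1) - 1"
      by (rule ln_le_minus_one) (use s[OF k'(4)] s[OF k'(6)] in auto)
    moreover have "ln (s (k - 1) / s (k + 1)) = ln (s (k - 1)) - ln (s (k + 1))"
      using s[OF k'(4)] s[OF k'(6)] by (simp add: ln_div)
    ultimately show ?thesis using 3 by linarith
  qed
  have tele: "(\<Sum>k=1..m. 1 + ln (s (k - 1)) - ln (s (k + 1)))
      = real m + ln (s 0) + ln (s 1) - ln (s m) - ln (s (m + 1))" for m
    by (induction m) auto
  have ln: "0 \<le> ln (s k)" "ln (s k) \<le> ln P" if "k \<le> n + 1" for k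
    using s[OF that] by auto
  have "real n - 2 * ln P \<le> (\<Sum>k=1..n. 1 + ln (s (k - 1)) - ln (s (k + 1)))"
    unfolding tele using ln[of 0] ln[of 1] ln[of n] ln[of "n + 1"] by simp
  also have "\<dots> \<le> (\<Sum>k=1..n. q k)" by (rule sum_mono[OF q])
  finally have "(real n - 2 * ln P) / n \<le> (\<Sum>k=1..n. q k) / n"
    by (rule divide_right_mono) simp
  also have "(\<Sum>k=1..n. q k) / n = (\<Sum>b\<in>D. fan_weight n S b * fan_weight n T b)"
    unfolding q_def by (rule sum_fan_weight_mult[symmetric]) (use D S in auto)
  finally have overlap: "1 - 2 * ln P / n \<le> (\<Sum>b\<in>D. fan_weight n S b * fan_weight n T b)"
    using n by (simp add: diff_divide_distrib)
  have "(\<Sum>b\<in>D. (fan_weight n S b - fan_weight n T b)\<^sup>2) =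
      (\<Sum>b\<in>D. (fan_weight n S b)\<^sup>2) + (\<Sum>b\<in>D. (fan_weight n T b)\<^sup>2)
        - 2 * (\<Sum>b\<in>D. fan_weight n S b * fan_weight n T b)"
    by (simp add: power2_diff sum.distrib sum_subtractf sum_distrib_left mult.assoc)
  also have "\<dots> = 2 - 2 * (\<Sum>b\<in>D. fan_weight n S b * fan_weight n T b)"
    using sum_fan_weight_squared[of D n S] sum_fan_weight_squared[of D n T] D n S T by simp
  finally have "(\<Sum>b\<in>D. (fan_weight n S b - fan_weight n T b)\<^sup>2) \<le> 2 * (2 * ln P / n)"
    using overlap by linarith
  then show ?thesis by simp
qed

lemma norm_diff_scaled_unit_vectors:
  fixes u v :: "'v :: real_inner"
  assumes "norm u = 1" "norm v = 1"
  shows "(norm (a *\<^sub>R u - b *\<^sub>R v))\<^sup>2 = (a - b)\<^sup>2 + a * b * (norm (u - v))\<^sup>2"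
proof -
  have "inner u u = 1" "inner v v = 1" using assms by (simp_all add: dot_square_norm)
  then show ?thesis
    by (simp add: power2_norm_eq_inner inner_diff_left inner_diff_right inner_commute)
      (simp add: power2_eq_square algebra_simps)
qed

text \<open>
  The two terms separate the change of the weights from the change of the vectors. In the
  application the weights live on the quotient and the vectors on the fibres.
\<close>

lemma weighted_sum_of_unit_vectors:
  fixes a :: "'x \<Rightarrow> 'b \<Rightarrow> real" and v :: "'x \<Rightarrow> 'b \<Rightarrow> 'c ell2" and supp :: "'x \<Rightarrow> 'b set"
  assumes supp: "\<And>x. x \<in> X \<Longrightarrow> finite (supp x)" "\<And>x b. x \<in> X \<Longrightarrow> b \<notin> supp x \<Longrightarrow> a x b = 0"
    and v: "\<And>x b. norm (v x b) = 1"
  shows "\<exists>F :: 'x \<Rightarrow> ('b \<times> 'c) ell2. \<forall>x\<in>X. \<forall>y\<in>X. (norm (F x - F y))\<^sup>2 =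
    (\<Sum>b\<in>supp x \<union> supp y. (a x b - a y b)\<^sup>2 + a x b * a y b * (norm (v x b - v y b))\<^sup>2)"
proof -
  have summ: "(\<lambda>b. (norm (a x b *\<^sub>R v x b))\<^sup>2) summable_on UNIV" if "x \<in> X" for x
  proof -
    have "(\<lambda>b. (norm (a x b *\<^sub>R v x b))\<^sup>2) summable_on supp x"
      using supp(1)[OF that] by simp
    then show ?thesis
      by (rule summable_on_cong_neutral[THEN iffD1, rotated -1]) (use supp(2)[OF that] in auto)
  qed
  define F :: "'x \<Rightarrow> ('b \<times> 'c) ell2"
    where "F x = Abs_ell2 (\<lambda>(b, c). ell2_coord (a x b *\<^sub>R v x b) c)" for x
  have "(norm (F x - F y))\<^sup>2 =
    (\<Sum>b\<in>supp x \<union> supp y. (a x b - a y b)\<^sup>2 + a x b * a y b * (norm (v x b - v y b))\<^sup>2)"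
    if "x \<in> X" "y \<in> X" for x y
  proof -
    have "((\<lambda>b. (norm (a x b *\<^sub>R v x b - a y b *\<^sub>R v y b))\<^sup>2) has_sum (norm (F x - F y))\<^sup>2) UNIV"
      unfolding F_def by (rule norm_diff_hilbert_sum[OF summ summ]) fact+
    also have "?this \<longleftrightarrow> ((\<lambda>b. (norm (a x b *\<^sub>R v x b - a y b *\<^sub>R v y b))\<^sup>2) has_sum (norm (F x - F y))\<^sup>2)
        (supp x \<union> supp y)"
      by (rule has_sum_cong_neutral) (use supp(2) that in auto)
    finally show ?thesis
      using has_sum_unique[OF has_sum_finite[of "supp x \<union> supp y"]] supp(1) that
      by (fastforce simp: norm_diff_scaled_unit_vectors v)
  qed
  then show ?thesis by blast
qed

context hyperbolic_graph_metric
begin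

text \<open>
  Here \<open>u x p\<close> is to be thought of as the position of \<open>x\<close> after projection to the fibre over \<open>p\<close>. Such
  positions are only comparable when \<open>p\<close> is near the images of both points, and are unbounded in \<open>x\<close>.
  They are therefore made into unit vectors by the Gaussian map before they are averaged with the fan
  weights. The length \<open>L * (n + 1)\<close> of the geodesics is the largest radius that occurs, as the bound for
  the fans requires, and \<open>L * (2 * n + 1)\<close> is the resulting distance within which weights can be nonzero.
\<close>

lemma map_at_one_scale:
  fixes \<pi> :: "'x \<Rightarrow> 'a" and u :: "'x \<Rightarrow> 'a \<Rightarrow> 'i ell2" and Y :: "'x set" and L n :: nat
  defines "common x y p \<equiv> p \<in> X \<and> d (\<pi> x) p \<le> L * (2 * n + 1) \<and> d (\<pi> y) p \<le> L * (2 * n + 1)"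
  assumes \<pi>: "\<And>x. x \<in> Y \<Longrightarrow> \<pi> x \<in> X" and n: "n \<ge> 1"
  shows "\<exists>F :: 'x \<Rightarrow> ((nat \<times> 'a) \<times> 'i list) ell2. \<forall>x\<in>Y. \<forall>y\<in>Y.
      (\<forall>\<eta>\<ge>0. d (\<pi> x) (\<pi> y) \<le> L \<longrightarrow> (\<forall>p. common x y p \<longrightarrow> (norm (u x p - u y p))\<^sup>2 \<le> \<eta>) \<longrightarrow>
        (norm (F x - F y))\<^sup>2 \<le> 4 * ln (N * (2 * (L * (n + 1)) + 2)) / n + \<eta>) \<and>
      ((\<forall>p. common x y p \<longrightarrow> 1 \<le> norm (u x p - u y p)) \<longrightarrow> 2 / 3 \<le> (norm (F x - F y))\<^sup>2)"
proof -
  obtain E :: "'i ell2 \<Rightarrow> 'i list ell2" where E: "\<And>u v. inner (E u) (E v) = exp (- (norm (u - v))\<^sup>2 / 2)"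
    using gaussian_kernel_map by metis
  have E_unit: "norm (E u) = 1" for u
    by (simp add: norm_eq_sqrt_inner E)
  have E_diff: "(norm (E u - E v))\<^sup>2 = 2 - 2 * exp (- (norm (u - v))\<^sup>2 / 2)" for u v
    by (simp add: power2_norm_eq_inner inner_diff_left inner_diff_right E inner_commute[of "E v" "E u"])
  define S where "S x k = fan (L * (n + 1)) (L * k) (\<pi> x)" for x k
  define a where "a x = fan_weight n (S x)" for x
  define supp where "supp x = Sigma {1..n} (S x)" for x
  define P where "P = N * (2 * (L * (n + 1)) + 2)"
  have S: "finite (S x k) \<and> S x k \<noteq> {} \<and> card (S x k) \<le> P" if "x \<in> Y" "k \<le> n + 1" for x k
  proof -
    have le: "L * k \<le> L * (n + 1)" using that by (intro mult_le_mono2)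
    have "card (S x k) \<le> N * (2 * (L * k) + 2)" unfolding S_def by (rule fan_finite_card[OF \<pi>[OF that(1)] le])
    also have "\<dots> \<le> P" unfolding P_def using le by (intro mult_le_mono) auto
    finally show ?thesis
      using fan_finite_card(1)[OF \<pi>[OF that(1)] le] fan_nonempty[OF \<pi>[OF that(1)]] by (simp add: S_def)
  qed
  have S_step: "S x k \<subseteq> S y (k + 1)" if "x \<in> Y" "y \<in> Y" "d (\<pi> x) (\<pi> y) \<le> L" for x y k
    unfolding S_def by (rule fan_mono[of _ _ L]) (use that \<pi> in auto)
  have fin: "finite (supp x)" if "x \<in> Y" for x
    unfolding supp_def using S[OF that] by auto
  have common: "common x y (snd b)" if "b \<in> supp x" "b \<in> supp y" "x \<in> Y" "y \<in> Y" for x y b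
  proof -
    obtain k p where b: "b = (k, p)" "k \<le> n" "p \<in> S x k" "p \<in> S y k"
      using \<open>b \<in> supp x\<close> \<open>b \<in> supp y\<close> by (auto simp: supp_def)
    have "d (\<pi> z) p \<le> L * (2 * n + 1)" if "p \<in> S z k" "z \<in> Y" for z
    proof -
      have "d (\<pi> z) p \<le> real (L * k + L * (n + 1))"
        using dist_fan_le \<pi> that unfolding S_def by blast
      also have "\<dots> \<le> real (L * (2 * n + 1))"
        unfolding of_nat_le_iff using mult_le_mono2[OF b(2), of L] by (simp add: algebra_simps)
      finally show ?thesis .
    qed
    moreover have "p \<in> X" using b(3) fan_subset unfolding S_def by blast
    ultimately show ?thesis using b that by (simp add: common_def)
  qed
  have a_nonneg: "0 \<le> a x b" for x b
    by (auto simp: a_def fan_weight_def split: prod.split)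
  have a_supp: "a x b = 0" if "b \<notin> supp x" for x b
    using that by (auto simp: a_def supp_def fan_weight_def split: prod.split)
  obtain F :: "'x \<Rightarrow> ((nat \<times> 'a) \<times> 'i list) ell2" where F: "\<And>x y. x \<in> Y \<Longrightarrow> y \<in> Y \<Longrightarrow> (norm (F x - F y))\<^sup>2 =
    (\<Sum>b\<in>supp x \<union> supp y. (a x b - a y b)\<^sup>2 + a x b * a y b * (norm (E (u x (snd b)) - E (u y (snd b))))\<^sup>2)"
    using weighted_sum_of_unit_vectors[of Y supp a "\<lambda>x b. E (u x (snd b))", OF fin a_supp E_unit] by blast
  have sq: "(\<Sum>b\<in>supp x \<union> supp y. (a x b)\<^sup>2) = 1" "(\<Sum>b\<in>supp x \<union> supp y. (a y b)\<^sup>2) = 1"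
    if "x \<in> Y" "y \<in> Y" for x y
    unfolding a_def
    by (rule sum_fan_weight_squared; use fin S that n in \<open>auto simp: supp_def\<close>)+
  have expand: "(\<Sum>b\<in>supp x \<union> supp y. (a x b - a y b)\<^sup>2) = 2 - 2 * (\<Sum>b\<in>supp x \<union> supp y. a x b * a y b)"
    if "x \<in> Y" "y \<in> Y" for x y
    using sq[OF that]
    by (simp add: power2_diff sum.distrib sum_subtractf sum_distrib_left mult.assoc)
  have overlap: "(\<Sum>b\<in>supp x \<union> supp y. a x b * a y b) \<le> 1" if "x \<in> Y" "y \<in> Y" for x y
    using expand[OF that] sum_nonneg[of "supp x \<union> supp y" "\<lambda>b. (a x b - a y b)\<^sup>2"] by simp
  have upper: "(norm (F x - F y))\<^sup>2 \<le> 4 * ln P / n + \<eta>"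
    if xy: "x \<in> Y" "y \<in> Y" and adj: "d (\<pi> x) (\<pi> y) \<le> L" and "\<eta> \<ge> 0"
      and \<eta>: "\<And>p. common x y p \<Longrightarrow> (norm (u x p - u y p))\<^sup>2 \<le> \<eta>" for x y \<eta>
  proof -
    have adj': "d (\<pi> y) (\<pi> x) \<le> L" "d (\<pi> x) (\<pi> x) \<le> L"
      using dist_sym adj \<pi> xy dist_eq_0[of "\<pi> x" "\<pi> x"] by auto
    have "(\<Sum>b\<in>supp x \<union> supp y. a x b * a y b * (norm (E (u x (snd b)) - E (u y (snd b))))\<^sup>2)
        \<le> (\<Sum>b\<in>supp x \<union> supp y. a x b * a y b * \<eta>)"
    proof (rule sum_mono)
      fix b
      show "a x b * a y b * (norm (E (u x (snd b)) - E (u y (snd b))))\<^sup>2 \<le> a x b * a y b * \<eta>"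
      proof (cases "b \<in> supp x \<and> b \<in> supp y")
        case True
        have "(norm (E (u x (snd b)) - E (u y (snd b))))\<^sup>2 \<le> (norm (u x (snd b) - u y (snd b)))\<^sup>2"
          unfolding E_diff using exp_ge_add_one_self[of "- (norm (u x (snd b) - u y (snd b)))\<^sup>2 / 2"] by simp
        also have "\<dots> \<le> \<eta>" using \<eta> common True xy by blast
        finally show ?thesis using a_nonneg by (intro mult_left_mono) auto
      qed (use a_supp[of b x] a_supp[of b y] in auto)
    qed
    also have "\<dots> \<le> \<eta>"
      using mult_right_mono[OF overlap[OF xy] \<open>\<eta> \<ge> 0\<close>] by (simp add: sum_distrib_right)
    finally have 1: "(\<Sum>b\<in>supp x \<union> supp y. a x b * a y b * (norm (E (u x (snd b)) - E (u y (snd b))))\<^sup>2) \<le> \<eta>" .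
    have "(\<Sum>b\<in>supp x \<union> supp y. (a x b - a y b)\<^sup>2) \<le> 4 * ln P / n"
      unfolding a_def
      by (rule sum_fan_weight_diff_squared)
        (use fin xy S S_step adj adj' n in \<open>auto simp: supp_def\<close>)
    then show ?thesis using 1 by (simp add: F[OF xy] sum.distrib)
  qed
  have lower: "2 / 3 \<le> (norm (F x - F y))\<^sup>2"
    if xy: "x \<in> Y" "y \<in> Y" and far: "\<And>p. common x y p \<Longrightarrow> 1 \<le> norm (u x p - u y p)" for x y
  proof -
    \<comment> \<open>Only a third of the first term is kept: the sum is then exactly \<open>2 / 3\<close>, whether or not the
      weights of \<open>x\<close> and \<open>y\<close> overlap.\<close>
    have "(\<Sum>b\<in>supp x \<union> supp y. (a x b - a y b)\<^sup>2 / 3 + a x b * a y b * (2 / 3)) \<le> (norm (F x - F y))\<^sup>2"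
      unfolding F[OF xy]
    proof (intro sum_mono add_mono)
      fix b
      show "a x b * a y b * (2 / 3) \<le> a x b * a y b * (norm (E (u x (snd b)) - E (u y (snd b))))\<^sup>2"
      proof (cases "b \<in> supp x \<and> b \<in> supp y")
        case True
        then have "1 \<le> (norm (u x (snd b) - u y (snd b)))\<^sup>2"
          using far common xy by (simp add: one_le_power)
        then have "exp (- (norm (u x (snd b) - u y (snd b)))\<^sup>2 / 2) \<le> exp (- (1 / 2))"
          by simp
        also have "\<dots> = inverse (exp (1 / 2))" by (rule exp_minus)
        also have "\<dots> \<le> inverse (3 / 2)"
          using exp_ge_add_one_self[of "1 / 2"] by (intro le_imp_inverse_le) auto
        finally have "2 / 3 \<le> (norm (E (u x (snd b)) - E (u y (snd b))))\<^sup>2"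
          unfolding E_diff by simp
        then show ?thesis using a_nonneg by (intro mult_left_mono) auto
      qed (use a_supp[of b x] a_supp[of b y] in auto)
    qed simp
    moreover have "(\<Sum>b\<in>supp x \<union> supp y. (a x b - a y b)\<^sup>2 / 3 + a x b * a y b * (2 / 3)) = 2 / 3"
      unfolding sum.distrib using expand[OF xy]
      by (simp add: diff_divide_distrib flip: sum_divide_distrib sum_distrib_right)
    ultimately show ?thesis by simp
  qed
  show ?thesis
    by (rule exI[of _ F], intro ballI conjI allI impI) (use upper lower P_def in auto)
qed

end

section \<open>Summing the scales\<close>

context hyperbolic_graph_metric
begin

text \<open>
  The maps at the scales \<open>n = 2 ^ (10 * j)\<close> are added with weights \<open>2 ^ (3 * j)\<close>, after the fibre positions have
  been shrunk by \<open>2 ^ (15 * j)\<close>. At scale \<open>j\<close> the squared variation between adjacent points is of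
  order \<open>ln n / n\<close> from the fan weights and \<open>(2 ^ (10 * j) / 2 ^ (15 * j))\<^sup>2\<close> from the fibres, hence \<open>O(2 ^ (-9 * j))\<close>.
  Against the squared weights \<open>2 ^ (6 * j)\<close> this is summable, so the sum of the maps is Lipschitz. On the
  other hand scale \<open>j\<close> separates points as soon as their distance to the power \<open>\<beta>\<close> exceeds a multiple of
  \<open>2 ^ (15 * j)\<close>, and then it contributes \<open>2 ^ (3 * j)\<close> to the norm, up to a constant. The exponent is thus
  \<open>\<beta>\<close> times \<open>3 / 15\<close>.
\<close>

lemma compression_exponent_over_hyperbolic:
  fixes Y :: "'y set" and D :: "'y \<Rightarrow> 'y \<Rightarrow> real" and \<pi> :: "'y \<Rightarrow> 'a"
    and u :: "'y \<Rightarrow> 'a \<Rightarrow> 'i ell2" and L :: nat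
  assumes Y: "graph_metric Y D"
    and \<pi>: "\<And>x. x \<in> Y \<Longrightarrow> \<pi> x \<in> X"
      "\<And>x y. x \<in> Y \<Longrightarrow> y \<in> Y \<Longrightarrow> D x y \<le> 1 \<Longrightarrow> d (\<pi> x) (\<pi> y) \<le> L"
    and const: "0 < \<beta>" "\<beta> \<le> 1" "C > 0" "C' > 0" "c \<ge> 0" "c' \<ge> 0" "M \<ge> 0"
    and u_upper: "\<And>x y p R. x \<in> Y \<Longrightarrow> y \<in> Y \<Longrightarrow> p \<in> X \<Longrightarrow> d (\<pi> x) p \<le> R \<Longrightarrow> d (\<pi> y) p \<le> R \<Longrightarrow>
      norm (u x p - u y p) \<le> C * (D x y + M * R) + c"
    and u_lower: "\<And>x y p R. x \<in> Y \<Longrightarrow> y \<in> Y \<Longrightarrow> p \<in> X \<Longrightarrow> d (\<pi> x) p \<le> R \<Longrightarrow> d (\<pi> y) p \<le> R \<Longrightarrow>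
      M * R \<le> D x y \<Longrightarrow> 1 / C' * (D x y - M * R) powr \<beta> - c' \<le> norm (u x p - u y p)"
  shows "compression_exponent Y D (\<beta> / 5)"
proof -
  interpret Y: graph_metric Y D by (rule Y)
  \<comment> \<open>The powers of two are written as \<open>1024 = 2 ^ 10\<close>, \<open>32768 = 2 ^ 15\<close> and \<open>8 = 2 ^ 3\<close>.\<close>
  define n where "n j = (1024 :: nat) ^ j" for j
  have n: "n j \<ge> 1" "real (n j) = 1024 ^ j" for j by (simp_all add: n_def)
  define R where "R j = real (L * (2 * n j + 1))" for j
  have R: "0 \<le> R j" "R j \<le> 3 * L * 1024 ^ j" for j
    using mult_left_mono[of "2 * real (n j) + 1" "3 * real (n j)" "real L"] n[of j]
    by (simp_all add: R_def algebra_simps)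
  define \<epsilon> where "\<epsilon> j = 4 * ln (N * (2 * (L * (n j + 1)) + 2)) / n j + ((C * (1 + M * R j) + c) / 32768 ^ j)\<^sup>2" for j
  have "\<exists>F :: 'y \<Rightarrow> ((nat \<times> 'a) \<times> 'i list) ell2. \<forall>x\<in>Y. \<forall>y\<in>Y.
      (D x y \<le> 1 \<longrightarrow> (norm (F x - F y))\<^sup>2 \<le> \<epsilon> j) \<and>
      ((\<forall>p\<in>X. d (\<pi> x) p \<le> R j \<longrightarrow> d (\<pi> y) p \<le> R j \<longrightarrow> 32768 ^ j \<le> norm (u x p - u y p)) \<longrightarrow>
        2 / 3 \<le> (norm (F x - F y))\<^sup>2)" for j
  proof -
    have scaled: "norm (u x p /\<^sub>R 32768 ^ j - u y p /\<^sub>R 32768 ^ j) = norm (u x p - u y p) / 32768 ^ j" for x y p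
      by (simp add: divide_inverse_commute flip: scaleR_diff_right)
    have near: "(norm (u x p - u y p) / 32768 ^ j)\<^sup>2 \<le> ((C * (1 + M * R j) + c) / 32768 ^ j)\<^sup>2"
      if "x \<in> Y" "y \<in> Y" "D x y \<le> 1" "p \<in> X" "d (\<pi> x) p \<le> R j" "d (\<pi> y) p \<le> R j" for x y p
    proof -
      have "norm (u x p - u y p) \<le> C * (D x y + M * R j) + c"
        using u_upper that by blast
      also have "\<dots> \<le> C * (1 + M * R j) + c" using that const by simp
      finally show ?thesis by (intro power_mono divide_right_mono) auto
    qed
    obtain F :: "'y \<Rightarrow> ((nat \<times> 'a) \<times> 'i list) ell2" where F: "\<forall>x\<in>Y. \<forall>y\<in>Y.
      (\<forall>\<eta>\<ge>0. d (\<pi> x) (\<pi> y) \<le> L \<longrightarrow>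
        (\<forall>p. p \<in> X \<and> d (\<pi> x) p \<le> R j \<and> d (\<pi> y) p \<le> R j \<longrightarrow> (norm (u x p - u y p) / 32768 ^ j)\<^sup>2 \<le> \<eta>) \<longrightarrow>
        (norm (F x - F y))\<^sup>2 \<le> 4 * ln (N * (2 * (L * (n j + 1)) + 2)) / n j + \<eta>) \<and>
      ((\<forall>p. p \<in> X \<and> d (\<pi> x) p \<le> R j \<and> d (\<pi> y) p \<le> R j \<longrightarrow> 1 \<le> norm (u x p - u y p) / 32768 ^ j) \<longrightarrow>
        2 / 3 \<le> (norm (F x - F y))\<^sup>2)"
      using map_at_one_scale[where Y = Y and \<pi> = \<pi> and n = "n j" and L = L and u = "\<lambda>x p. u x p /\<^sub>R 32768 ^ j", OF \<pi>(1) n(1)]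
      unfolding scaled R_def by blast
    show ?thesis
    proof (rule exI[of _ F], intro ballI conjI impI)
      fix x y assume xy: "x \<in> Y" "y \<in> Y"
      { assume "D x y \<le> 1"
        then show "(norm (F x - F y))\<^sup>2 \<le> \<epsilon> j"
          unfolding \<epsilon>_def using F[rule_format, OF xy, THEN conjunct1] \<pi>(2)[OF xy] near[OF xy] by simp }
      { assume "\<forall>p\<in>X. d (\<pi> x) p \<le> R j \<longrightarrow> d (\<pi> y) p \<le> R j \<longrightarrow> 32768 ^ j \<le> norm (u x p - u y p)"
        then show "2 / 3 \<le> (norm (F x - F y))\<^sup>2"
          using F[rule_format, OF xy, THEN conjunct2] by simp }
    qed
  qed
  then obtain F :: "nat \<Rightarrow> 'y \<Rightarrow> ((nat \<times> 'a) \<times> 'i list) ell2" where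
    F_upper: "\<And>j x y. x \<in> Y \<Longrightarrow> y \<in> Y \<Longrightarrow> D x y \<le> 1 \<Longrightarrow> (norm (F j x - F j y))\<^sup>2 \<le> \<epsilon> j" and
    F_lower: "\<And>j x y. x \<in> Y \<Longrightarrow> y \<in> Y \<Longrightarrow>
      (\<And>p. p \<in> X \<Longrightarrow> d (\<pi> x) p \<le> R j \<Longrightarrow> d (\<pi> y) p \<le> R j \<Longrightarrow> 32768 ^ j \<le> norm (u x p - u y p)) \<Longrightarrow>
      2 / 3 \<le> (norm (F j x - F j y))\<^sup>2"
    by metis
  have "N \<ge> 1"
  proof -
    have "o' \<in> {y \<in> X. d o' y \<le> 4 * e}"
      using basepoint dist_eq_0[of o' o'] hyp_nonneg by simp
    then have "card {y \<in> X. d o' y \<le> 4 * e} \<ge> 1"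
      using finite_ball[OF basepoint] by (auto simp: Suc_le_eq card_gt_0_iff)
    then show ?thesis using card_ball_le[OF basepoint] by linarith
  qed
  define K where "K = 4 * (ln (N * (4 * L + 2)) + 1023) + (C * (1 + 3 * M * L) + c)\<^sup>2"
  have eps: "\<epsilon> j \<le> K / 512 ^ j" for j
  proof -
    \<comment> \<open>The factor \<open>2 ^ j\<close> absorbs the logarithm of \<open>n j\<close>, which is linear in \<open>j\<close>.\<close>
    have two: "(1 :: real) \<le> 2 ^ j" "real j \<le> 2 ^ j"
      using of_nat_mono[OF less_imp_le[OF less_exp[of j]], where 'a = real] by simp_all
    have ln_K: "0 \<le> ln (real (N * (4 * L + 2)))"
      using \<open>N \<ge> 1\<close> by (intro ln_ge_zero) (simp add: Suc_le_eq del: of_nat_mult of_nat_add)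
    have pos: "0 < real (N * (4 * L + 2))"
      using \<open>N \<ge> 1\<close> by (simp del: of_nat_mult of_nat_add)
    have "2 * (L * (n j + 1)) + 2 \<le> (4 * L + 2) * n j"
      using n(1)[of j] by (cases "n j") (auto simp: algebra_simps)
    then have "N * (2 * (L * (n j + 1)) + 2) \<le> N * (4 * L + 2) * n j"
      unfolding mult.assoc by (rule mult_le_mono2)
    then have "real (N * (2 * (L * (n j + 1)) + 2)) \<le> real (N * (4 * L + 2) * n j)"
      by (rule of_nat_mono)
    then have "ln (real (N * (2 * (L * (n j + 1)) + 2))) \<le> ln (real (N * (4 * L + 2) * n j))"
      by (rule ln_mono) (use \<open>N \<ge> 1\<close> in \<open>simp del: of_nat_mult of_nat_add\<close>)
    also have "\<dots> = ln (real (N * (4 * L + 2))) + ln (1024 ^ j)"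
      unfolding of_nat_mult[of "N * (4 * L + 2)"] n(2) by (rule ln_mult_pos[OF pos]) simp
    also have "ln (1024 ^ j :: real) = real j * ln 1024"
      by (rule ln_realpow)
    also have "ln (real (N * (4 * L + 2))) + real j * ln 1024 \<le>
        ln (real (N * (4 * L + 2))) * 2 ^ j + 2 ^ j * 1023"
    proof (intro add_mono mult_mono)
      show "ln (1024 :: real) \<le> 1023"
        using ln_le_minus_one[of "1024 :: real"] by simp
      show "ln (real (N * (4 * L + 2))) \<le> ln (real (N * (4 * L + 2))) * 2 ^ j"
        using mult_left_mono[OF two(1) ln_K] by simp
    qed (use two in auto)
    finally have ln: "ln (real (N * (2 * (L * (n j + 1)) + 2))) \<le> (ln (real (N * (4 * L + 2))) + 1023) * 2 ^ j"
      by (simp add: algebra_simps)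
    have pow: "(1024 :: real) ^ j = 512 ^ j * 2 ^ j" "(32768 :: real) ^ j = 32 ^ j * 1024 ^ j" "(1024 :: real) ^ j = (32 ^ j)\<^sup>2"
      unfolding power2_eq_square by (simp_all flip: power_mult_distrib)
    have "4 * ln (real (N * (2 * (L * (n j + 1)) + 2))) / n j \<le>
        4 * ((ln (real (N * (4 * L + 2))) + 1023) * 2 ^ j) / n j"
      using ln by (intro divide_right_mono mult_left_mono) auto
    also have "\<dots> = 4 * (ln (real (N * (4 * L + 2))) + 1023) / 512 ^ j"
      unfolding n(2) pow(1) by simp
    finally have 1: "4 * ln (real (N * (2 * (L * (n j + 1)) + 2))) / n j \<le> 4 * (ln (real (N * (4 * L + 2))) + 1023) / 512 ^ j" .
    have "M * R j \<le> M * (3 * L * 1024 ^ j)"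
      using R[of j] const by (intro mult_left_mono) auto
    then have "C * (1 + M * R j) + c \<le> C * (1 * 1024 ^ j + 3 * M * L * 1024 ^ j) + c * 1024 ^ j"
      using const by (intro add_mono mult_left_mono) (auto simp: mult_ge1_I mult_le_cancel_left1 algebra_simps)
    also have "\<dots> = (C * (1 + 3 * M * L) + c) * 1024 ^ j" by (simp add: algebra_simps)
    finally have "(C * (1 + M * R j) + c) / 32768 ^ j \<le> (C * (1 + 3 * M * L) + c) * 1024 ^ j / 32768 ^ j"
      by (rule divide_right_mono) simp
    also have "\<dots> = (C * (1 + 3 * M * L) + c) / 32 ^ j"
      unfolding pow(2) by simp
    finally have "((C * (1 + M * R j) + c) / 32768 ^ j)\<^sup>2 \<le> ((C * (1 + 3 * M * L) + c) / 32 ^ j)\<^sup>2"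
      using const R(1)[of j] by (intro power_mono) auto
    also have "\<dots> = (C * (1 + 3 * M * L) + c)\<^sup>2 / 1024 ^ j"
      unfolding pow(3) by (simp add: power_divide)
    also have "\<dots> \<le> (C * (1 + 3 * M * L) + c)\<^sup>2 / 512 ^ j"
      by (intro divide_left_mono power_mono) auto
    finally show ?thesis
      using 1 unfolding \<epsilon>_def K_def by (simp add: add_divide_distrib)
  qed
  have "K \<ge> 0"
  proof -
    have "0 \<le> ln (real (N * (4 * L + 2)))"
      using \<open>N \<ge> 1\<close> by (intro ln_ge_zero) (simp add: Suc_le_eq del: of_nat_mult of_nat_add)
    then show ?thesis unfolding K_def by (intro add_nonneg_nonneg) auto
  qed
  have F_lipschitz: "(norm (8 ^ j *\<^sub>R F j x - 8 ^ j *\<^sub>R F j y))\<^sup>2 \<le> K * (D x y)\<^sup>2 * (1 / 8) ^ j"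
    if "x \<in> Y" "y \<in> Y" for j x y
  proof -
    have "norm (F j x - F j y) \<le> sqrt (K / 512 ^ j) * D x y"
    proof (rule Y.lipschitz_of_adjacent[OF _ that])
      show "norm (F j x - F j y) \<le> sqrt (K / 512 ^ j)" if "x \<in> Y" "y \<in> Y" "D x y \<le> 1" for x y
        using order_trans[OF F_upper[OF that] eps] by (intro real_le_rsqrt)
    qed
    then have "(norm (F j x - F j y))\<^sup>2 \<le> (sqrt (K / 512 ^ j) * D x y)\<^sup>2"
      by (intro power_mono) auto
    also have "\<dots> = K / 512 ^ j * (D x y)\<^sup>2"
      using \<open>K \<ge> 0\<close> by (simp add: power_mult_distrib)
    finally have "64 ^ j * (norm (F j x - F j y))\<^sup>2 \<le> 64 ^ j * (K / 512 ^ j * (D x y)\<^sup>2)"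
      by (intro mult_left_mono) auto
    also have "\<dots> = K * (D x y)\<^sup>2 * (64 ^ j / 512 ^ j)" by simp
    also have "64 ^ j / 512 ^ j = (1 / 8 :: real) ^ j" by (simp flip: power_divide)
    also have "(64 :: real) ^ j = (8 ^ j)\<^sup>2"
      unfolding power2_eq_square by (simp flip: power_mult_distrib)
    also have "(8 ^ j)\<^sup>2 * (norm (F j x - F j y))\<^sup>2 = (norm (8 ^ j *\<^sub>R F j x - 8 ^ j *\<^sub>R F j y))\<^sup>2"
      by (simp add: power_mult_distrib flip: scaleR_diff_right)
    finally show ?thesis .
  qed
  have geometric: "((\<lambda>j. K * (D x y)\<^sup>2 * (1 / 8) ^ j) has_sum K * (D x y)\<^sup>2 * (8 / 7)) UNIV" for x y
    using geometric_sums[of "1 / 8 :: real"]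
    by (intro has_sum_cmult_right sums_nonneg_imp_has_sum) auto
  have "\<exists>\<Phi> :: 'y \<Rightarrow> (nat \<times> (nat \<times> 'a) \<times> 'i list) ell2. \<forall>x\<in>Y. \<forall>y\<in>Y.
    ((\<lambda>j. (norm (8 ^ j *\<^sub>R F j x - 8 ^ j *\<^sub>R F j y))\<^sup>2) has_sum (norm (\<Phi> x - \<Phi> y))\<^sup>2) UNIV"
    by (rule hilbert_sum_of_maps)
      (rule summable_on_comparison_test[OF has_sum_imp_summable[OF geometric]], use F_lipschitz in auto)
  then obtain \<Phi> :: "'y \<Rightarrow> (nat \<times> (nat \<times> 'a) \<times> 'i list) ell2" where \<Phi>: "\<And>x y. x \<in> Y \<Longrightarrow> y \<in> Y \<Longrightarrow>
    ((\<lambda>j. (norm (8 ^ j *\<^sub>R F j x - 8 ^ j *\<^sub>R F j y))\<^sup>2) has_sum (norm (\<Phi> x - \<Phi> y))\<^sup>2) UNIV"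
    by blast
  have \<Phi>_upper: "norm (\<Phi> x - \<Phi> y) \<le> (sqrt (2 * K) + 1) * D x y + 0" if xy: "x \<in> Y" "y \<in> Y" for x y
  proof -
    have "(norm (\<Phi> x - \<Phi> y))\<^sup>2 \<le> K * (D x y)\<^sup>2 * (8 / 7)"
      by (rule has_sum_mono[OF \<Phi>[OF xy] geometric]) (rule F_lipschitz[OF xy])
    also have "\<dots> \<le> K * (D x y)\<^sup>2 * 2"
      using \<open>K \<ge> 0\<close> by (intro mult_left_mono) auto
    also have "\<dots> = (sqrt (2 * K) * D x y)\<^sup>2"
      using \<open>K \<ge> 0\<close> by (simp add: power_mult_distrib)
    finally have "norm (\<Phi> x - \<Phi> y) \<le> sqrt (2 * K) * D x y"
      by (rule power2_le_imp_le) (use \<open>K \<ge> 0\<close> Y.dist_nonneg[OF xy] in simp)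
    then show ?thesis using Y.dist_nonneg[OF xy] by (simp add: distrib_right)
  qed
  \<comment> \<open>The first summand outweighs the constants of the lower estimate for \<open>u\<close>, the second keeps
    the distance above twice the loss \<open>M * R j\<close>, and the third makes \<open>B \<ge> 1\<close>.\<close>
  define B where "B = 2 * C' * (1 + c') + 6 * L * M + 1"
  have B: "B \<ge> 1" "B \<ge> 6 * L * M" "B \<ge> 2 * C' * (1 + c')"
    using const by (auto simp: B_def)
  have \<Phi>_scale: "8 ^ j / 2 \<le> norm (\<Phi> x - \<Phi> y)"
    if xy: "x \<in> Y" "y \<in> Y" and far: "B * 32768 ^ j \<le> D x y powr \<beta>" for x y j
  proof -
    have "1 * 1 \<le> B * 32768 ^ j" using B by (intro mult_mono) auto
    then have "1 \<le> D x y powr \<beta>" using far by linarith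
    then have "D x y \<noteq> 0" by auto
    then have D1: "D x y \<ge> 1"
      using Y.dist_Nats[OF xy] by (auto elim!: Nats_cases)
    have "D x y powr \<beta> \<le> D x y powr 1" using D1 const by (intro powr_mono) auto
    then have "B * 32768 ^ j \<le> D x y" using far D1 by simp
    moreover have "6 * L * M * 1024 ^ j \<le> B * 32768 ^ j"
      using B by (intro mult_mono power_mono) auto
    moreover have "M * R j \<le> M * (3 * L * 1024 ^ j)"
      using R[of j] const by (intro mult_left_mono) auto
    ultimately have half: "D x y / 2 \<le> D x y - M * R j"
      by (simp add: algebra_simps)
    have "D x y powr \<beta> / 2 \<le> (D x y / 2) powr \<beta>"
    proof -
      have "2 powr \<beta> \<le> (2 :: real) powr 1" using const by (intro powr_mono) auto
      then have "D x y powr \<beta> / 2 \<le> D x y powr \<beta> / 2 powr \<beta>"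
        by (intro divide_left_mono) auto
      then show ?thesis using D1 by (simp add: powr_divide)
    qed
    also have "\<dots> \<le> (D x y - M * R j) powr \<beta>"
      using half D1 const by (intro powr_mono2) auto
    finally have powr: "B * 32768 ^ j / 2 \<le> (D x y - M * R j) powr \<beta>" using far by simp
    have "32768 ^ j \<le> norm (u x p - u y p)"
      if p: "p \<in> X" "d (\<pi> x) p \<le> R j" "d (\<pi> y) p \<le> R j" for p
    proof -
      have "2 * (C' * ((1 + c') * 32768 ^ j)) = 2 * C' * (1 + c') * 32768 ^ j" by simp
      also have "\<dots> \<le> B * 32768 ^ j"
        using B by (intro mult_right_mono) auto
      finally have "C' * ((1 + c') * 32768 ^ j) \<le> (D x y - M * R j) powr \<beta>" using powr by linarith
      then have "(1 + c') * 32768 ^ j \<le> 1 / C' * (D x y - M * R j) powr \<beta>"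
        using const by (simp add: pos_le_divide_eq mult.commute)
      moreover have "c' * 1 \<le> c' * 32768 ^ j" using const by (intro mult_left_mono) auto
      ultimately have "32768 ^ j \<le> 1 / C' * (D x y - M * R j) powr \<beta> - c'"
        by (simp add: algebra_simps)
      also have "\<dots> \<le> norm (u x p - u y p)"
        by (rule u_lower[OF xy p]) (use half D1 in auto)
      finally show ?thesis .
    qed
    from F_lower[OF xy this] have F: "2 / 3 \<le> (norm (F j x - F j y))\<^sup>2" by blast
    have "(8 ^ j / 2)\<^sup>2 = (8 ^ j)\<^sup>2 * (1 / 4 :: real)" by (simp add: power_divide)
    also have "\<dots> \<le> (8 ^ j)\<^sup>2 * (norm (F j x - F j y))\<^sup>2"
      using F by (intro mult_left_mono) auto
    also have "\<dots> = (\<Sum>j\<in>{j}. (norm (8 ^ j *\<^sub>R F j x - 8 ^ j *\<^sub>R F j y))\<^sup>2)"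
      by (simp add: power_mult_distrib flip: scaleR_diff_right)
    also have "\<dots> \<le> (norm (\<Phi> x - \<Phi> y))\<^sup>2"
      by (rule finite_sum_le_has_sum[OF \<Phi>[OF xy]]) auto
    finally show ?thesis by (rule power2_le_imp_le) simp
  qed
  have \<Phi>_lower: "1 / (16 * B) * D x y powr (\<beta> / 5) - 1 \<le> norm (\<Phi> x - \<Phi> y)"
    if xy: "x \<in> Y" "y \<in> Y" for x y
  proof -
    define z where "z = D x y powr (\<beta> / 5)"
    have z: "z \<ge> 0" "z ^ 5 = D x y powr \<beta>"
      unfolding z_def by simp (cases "D x y = 0"; simp add: powr_power)
    have B5: "B \<le> B ^ 5" using B power_increasing[of 1 5 B] by simp
    obtain k where k: "z ^ 5 < B * 32768 ^ k"
    proof -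
      obtain k where "z ^ 5 < 32768 ^ k" using real_arch_pow[of 32768 "z ^ 5"] by auto
      also have "\<dots> \<le> B * 32768 ^ k" using B by simp
      finally show thesis by (rule that)
    qed
    \<comment> \<open>The first scale whose threshold the distance does not reach: the scale before it separates
      \<open>x\<close> and \<open>y\<close>, and if there is none, the distance is bounded.\<close>
    define m where "m = (LEAST k. z ^ 5 < B * 32768 ^ k)"
    have m: "z ^ 5 < B * 32768 ^ m" unfolding m_def by (rule LeastI[of _ k]) (rule k)
    have "((8 :: real) ^ m) ^ 5 = (8 ^ 5) ^ m"
      by (simp only: power_mult[symmetric] mult.commute)
    then have pow5: "(B * 8 ^ m) ^ 5 = B ^ 5 * 32768 ^ m"
      by (simp add: power_mult_distrib)
    note m
    also have "B * 32768 ^ m \<le> B ^ 5 * 32768 ^ m"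
      by (rule mult_right_mono[OF B5]) simp
    finally have "z ^ 5 < (B * 8 ^ m) ^ 5" unfolding pow5 .
    then have less: "z < B * 8 ^ m"
      by (rule power_less_imp_less_base) (use B in auto)
    show ?thesis
    proof (cases m)
      case 0
      then have "z \<le> 16 * B" using less B by simp
      then have "1 / (16 * B) * z \<le> 1" using B by (simp add: divide_le_eq)
      then show ?thesis unfolding z_def using norm_ge_zero[of "\<Phi> x - \<Phi> y"] by linarith
    next
      case (Suc j)
      then have "\<not> z ^ 5 < B * 32768 ^ j"
        unfolding m_def by (intro not_less_Least) simp
      then have "8 ^ j / 2 \<le> norm (\<Phi> x - \<Phi> y)"
        using \<Phi>_scale[OF xy, of j] z by simp
      moreover have "1 / (16 * B) * z \<le> 8 ^ j / 2"
        using less B Suc by (simp add: field_simps)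
      ultimately show ?thesis unfolding z_def by linarith
    qed
  qed
  show ?thesis
    by (rule compression_exponentI[of _ "sqrt (2 * K) + 1" "16 * B" 0 1 Y D \<Phi>])
      (use \<Phi>_upper \<Phi>_lower B \<open>K \<ge> 0\<close> const in \<open>auto simp: add_nonneg_pos\<close>)
qed

end

section \<open>Word metrics\<close>

locale word_metric_group = group G for G (structure) +
  fixes S
  assumes gen: "finite_symmetric_generating_set G S"
begin

abbreviation "len \<equiv> word_length G S"
abbreviation "wdist \<equiv> length_metric G len"
abbreviation "word_prod ws \<equiv> foldr (\<otimes>) ws \<one>"

lemma S_carrier: "S \<subseteq> carrier G" and finite_S: "finite S"
  and S_inv: "s \<in> S \<Longrightarrow> inv s \<in> S" and S_generate: "generate G S = carrier G"
  using gen by (auto simp: finite_symmetric_generating_set_def)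

lemma word_prod_closed [simp]: "set ws \<subseteq> S \<Longrightarrow> word_prod ws \<in> carrier G"
  by (induction ws) (use S_carrier in auto)

lemma word_prod_append:
  "set ws \<subseteq> S \<Longrightarrow> set vs \<subseteq> S \<Longrightarrow> word_prod (ws @ vs) = word_prod ws \<otimes> word_prod vs"
  by (induction ws) (use S_carrier in \<open>auto simp: m_assoc\<close>)

lemma word_prod_inv:
  "set ws \<subseteq> S \<Longrightarrow> inv (word_prod ws) = word_prod (rev (map (\<lambda>s. inv s) ws))"
proof (induction ws)
  case (Cons s ws)
  then have s: "s \<in> carrier G" "inv s \<in> S" "set (rev (map (\<lambda>s. inv s) ws)) \<subseteq> S"
    using S_carrier S_inv by auto
  have "inv (word_prod (s # ws)) = inv (word_prod ws) \<otimes> inv s"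
    using Cons.prems s by (simp add: inv_mult_group)
  also have "\<dots> = word_prod (rev (map (\<lambda>s. inv s) ws) @ [inv s])"
    using word_prod_append[OF s(3), of "[inv s]"] Cons s by simp
  finally show ?case by simp
qed simp

lemma word_exists:
  assumes "x \<in> carrier G"
  shows "\<exists>ws. set ws \<subseteq> S \<and> word_prod ws = x"
proof -
  have "x \<in> generate G S" using assms S_generate by simp
  then show ?thesis
  proof (induction rule: generate.induct)
    case one
    show ?case by (rule exI[of _ "[]"]) simp
  next
    case (incl s)
    then show ?case using S_carrier by (intro exI[of _ "[s]"]) auto
  next
    case (inv s)
    then show ?case using S_carrier S_inv by (intro exI[of _ "[inv s]"]) auto
  next
    case (eng x y)
    then obtain ws vs where "set ws \<subseteq> S" "word_prod ws = x" "set vs \<subseteq> S" "word_prod vs = y" by blast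
    then show ?case using word_prod_append by (intro exI[of _ "ws @ vs"]) auto
  qed
qed

lemma geodesic_word:
  assumes "x \<in> carrier G"
  obtains ws where "set ws \<subseteq> S" "word_prod ws = x" "len x = real (length ws)"
proof -
  have "\<exists>n ws. length ws = n \<and> set ws \<subseteq> S \<and> word_prod ws = x"
    using word_exists[OF assms] by blast
  from LeastI_ex[OF this] show thesis
    using that unfolding word_length_def by metis
qed

lemma len_word_prod_le: "set ws \<subseteq> S \<Longrightarrow> len (word_prod ws) \<le> real (length ws)"
  unfolding word_length_def of_nat_le_iff by (rule Least_le) blast

lemma len_mult_le: "x \<in> carrier G \<Longrightarrow> y \<in> carrier G \<Longrightarrow> len (x \<otimes> y) \<le> len x + len y"
  by (elim geodesic_word) (use len_word_prod_le[of "_ @ _"] word_prod_append in force)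

lemma len_inv: "x \<in> carrier G \<Longrightarrow> len (inv x) = len x"
proof -
  have le: "len (inv x) \<le> len x" if x: "x \<in> carrier G" for x
  proof -
    obtain ws where ws: "set ws \<subseteq> S" "word_prod ws = x" "len x = real (length ws)"
      using geodesic_word[OF x] .
    have "set (rev (map (\<lambda>s. inv s) ws)) \<subseteq> S" using ws(1) S_inv by auto
    from len_word_prod_le[OF this] show ?thesis
      using word_prod_inv[OF ws(1)] ws by simp
  qed
  assume "x \<in> carrier G"
  then show ?thesis using le[of x] le[of "inv x"] by simp
qed

lemma len_Nats: "len x \<in> \<nat>"
  by (simp add: word_length_def)

lemma len_nonneg: "0 \<le> len x"
  by (simp add: word_length_def)

lemma len_eq_0_iff: "x \<in> carrier G \<Longrightarrow> len x = 0 \<longleftrightarrow> x = \<one>"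
  using len_word_prod_le[of "[]"] len_Nats[of \<one>] by (auto elim!: geodesic_word Nats_cases)

lemma finite_len_ball: "finite {x \<in> carrier G. len x \<le> r}"
proof (rule finite_subset)
  show "{x \<in> carrier G. len x \<le> r} \<subseteq> word_prod ` {ws. set ws \<subseteq> S \<and> length ws \<le> nat \<lfloor>r\<rfloor>}"
  proof
    fix x assume "x \<in> {x \<in> carrier G. len x \<le> r}"
    then have x: "x \<in> carrier G" "len x \<le> r" by auto
    obtain ws where "set ws \<subseteq> S" "word_prod ws = x" "len x = real (length ws)"
      using geodesic_word[OF x(1)] .
    then show "x \<in> word_prod ` {ws. set ws \<subseteq> S \<and> length ws \<le> nat \<lfloor>r\<rfloor>}"
      using x(2) by (auto simp: le_nat_floor intro!: image_eqI[of _ _ ws])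
  qed
  show "finite (word_prod ` {ws. set ws \<subseteq> S \<and> length ws \<le> nat \<lfloor>r\<rfloor>})"
    by (intro finite_imageI finite_lists_length_le finite_S)
qed

lemma mult_inv_cancel_left:
  "x \<in> carrier G \<Longrightarrow> y \<in> carrier G \<Longrightarrow> x \<otimes> (inv x \<otimes> y) = y"
  "x \<in> carrier G \<Longrightarrow> y \<in> carrier G \<Longrightarrow> inv x \<otimes> (x \<otimes> y) = y"
  by (simp_all flip: m_assoc)

lemma graph_metric_wdist: "graph_metric (carrier G) wdist"
proof
  fix x y assume xy: "x \<in> carrier G" "y \<in> carrier G"
  show "wdist x y \<in> \<nat>" by (simp add: length_metric_def len_Nats)
  have "x = y" if "inv x \<otimes> y = \<one>"
    using mult_inv_cancel_left(1)[OF xy] xy unfolding that by simp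
  then show "wdist x y = 0 \<longleftrightarrow> x = y"
    using xy len_eq_0_iff[of "inv x \<otimes> y"] by (auto simp: length_metric_def)
  show "wdist x y = wdist y x"
    using xy len_inv[of "inv x \<otimes> y"] by (simp add: length_metric_def inv_mult_group)
  show "wdist x z \<le> wdist x y + wdist y z" if z: "z \<in> carrier G" for z
    using len_mult_le[of "inv x \<otimes> y" "inv y \<otimes> z"] xy z
    by (simp add: length_metric_def m_assoc mult_inv_cancel_left)
  show "\<exists>z\<in>carrier G. wdist x z = real m \<and> wdist z y = wdist x y - real m"
    if m: "real m \<le> wdist x y" for m
  proof -
    have g: "inv x \<otimes> y \<in> carrier G" using xy by simp
    obtain ws where ws: "set ws \<subseteq> S" "word_prod ws = inv x \<otimes> y" "len (inv x \<otimes> y) = real (length ws)"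
      using geodesic_word[OF g] .
    define a b where "a = word_prod (take m ws)" and "b = word_prod (drop m ws)"
    have sub: "set (take m ws) \<subseteq> S" "set (drop m ws) \<subseteq> S"
      using ws(1) set_take_subset[of m ws] set_drop_subset[of m ws] by auto
    have ab: "a \<in> carrier G" "b \<in> carrier G" "a \<otimes> b = inv x \<otimes> y"
      using word_prod_append[OF sub] sub ws(2) by (auto simp: a_def b_def)
    have "m \<le> length ws" using m ws(3) by (simp add: length_metric_def)
    then have "len a \<le> real m" "len b \<le> real (length ws) - real m"
      using len_word_prod_le[OF sub(1)] len_word_prod_le[OF sub(2)] by (simp_all add: a_def b_def)
    moreover have "real (length ws) \<le> len a + len b"
      using len_mult_le[OF ab(1,2)] ab(3) ws(3) by simp
    \<comment> \<open>Prefix and suffix of a geodesic word are geodesic: neither inequality can be strict.\<close>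
    ultimately have len: "len a = real m" "len b = real (length ws) - real m" by linarith+
    have y: "y = x \<otimes> (a \<otimes> b)" using ab(3) xy by (simp add: mult_inv_cancel_left)
    have "inv (x \<otimes> a) \<otimes> y = b"
      unfolding y using ab(1,2) xy by (simp add: inv_mult_group m_assoc mult_inv_cancel_left)
    moreover have "inv x \<otimes> (x \<otimes> a) = a" using ab(1) xy by (simp add: mult_inv_cancel_left)
    ultimately show ?thesis
      using len ws(3) ab(1) xy by (intro bexI[of _ "x \<otimes> a"]) (auto simp: length_metric_def)
  qed
qed

lemma finite_wdist_ball: "x \<in> carrier G \<Longrightarrow> finite {y \<in> carrier G. wdist x y \<le> r}"
  and card_wdist_ball_le: "x \<in> carrier G \<Longrightarrow>
    card {y \<in> carrier G. wdist x y \<le> r} \<le> card {g \<in> carrier G. len g \<le> r}"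
proof -
  assume x: "x \<in> carrier G"
  have "{y \<in> carrier G. wdist x y \<le> r} \<subseteq> (\<lambda>g. x \<otimes> g) ` {g \<in> carrier G. len g \<le> r}"
  proof
    fix y assume "y \<in> {y \<in> carrier G. wdist x y \<le> r}"
    then show "y \<in> (\<lambda>g. x \<otimes> g) ` {g \<in> carrier G. len g \<le> r}"
      using x by (intro image_eqI[of _ _ "inv x \<otimes> y"]) (auto simp: length_metric_def mult_inv_cancel_left)
  qed
  with finite_len_ball show "finite {y \<in> carrier G. wdist x y \<le> r}"
      "card {y \<in> carrier G. wdist x y \<le> r} \<le> card {g \<in> carrier G. len g \<le> r}"
    by (auto intro: finite_surj surj_card_le)
qed

text \<open>
  Lifting a geodesic word letter by letter gives a set-theoretic section that stretches lengths by at
  most a constant factor.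
\<close>

lemma linear_section:
  assumes "group \<Gamma>" and \<pi>: "\<pi> \<in> epi \<Gamma> G" and "finite_symmetric_generating_set \<Gamma> T"
  obtains \<sigma> M where "M \<ge> 0" "\<And>g. g \<in> carrier G \<Longrightarrow> \<sigma> g \<in> carrier \<Gamma> \<and> \<pi> (\<sigma> g) = g \<and>
    word_length \<Gamma> T (\<sigma> g) \<le> M * len g"
proof -
  interpret \<Gamma>: word_metric_group \<Gamma> T
    using assms by (simp add: word_metric_group_def word_metric_group_axioms_def)
  have hom: "\<pi> \<in> hom \<Gamma> G" and surj: "\<pi> ` carrier \<Gamma> = carrier G"
    using \<pi> by (auto simp: epi_def)
  interpret \<pi>: group_hom \<Gamma> G \<pi>
    by (simp add: group_hom_def group_hom_axioms_def hom assms(1) is_group)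
  define \<tau> where "\<tau> = inv_into (carrier \<Gamma>) \<pi>"
  have \<tau>: "\<tau> s \<in> carrier \<Gamma>" "\<pi> (\<tau> s) = s" if "s \<in> S" for s
    using that S_carrier surj inv_into_into[of s \<pi> "carrier \<Gamma>"] f_inv_into_f[of s \<pi> "carrier \<Gamma>"]
    unfolding \<tau>_def by auto
  obtain M where M: "M \<ge> 0" "\<And>s. s \<in> S \<Longrightarrow> word_length \<Gamma> T (\<tau> s) \<le> M"
  proof
    show "Max (insert 0 ((\<lambda>s. word_length \<Gamma> T (\<tau> s)) ` S)) \<ge> 0" using finite_S by simp
    show "word_length \<Gamma> T (\<tau> s) \<le> Max (insert 0 ((\<lambda>s. word_length \<Gamma> T (\<tau> s)) ` S))" if "s \<in> S" for s
      using finite_S that by (intro Max_ge) auto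
  qed
  have lift: "\<exists>x\<in>carrier \<Gamma>. \<pi> x = word_prod ws \<and> word_length \<Gamma> T x \<le> M * length ws"
    if "set ws \<subseteq> S" for ws
    using that
  proof (induction ws)
    case Nil
    then show ?case using \<Gamma>.len_eq_0_iff[of "\<one>\<^bsub>\<Gamma>\<^esub>"] by (intro bexI[of _ "\<one>\<^bsub>\<Gamma>\<^esub>"]) auto
  next
    case (Cons s ws)
    then obtain x where x: "x \<in> carrier \<Gamma>" "\<pi> x = word_prod ws" "word_length \<Gamma> T x \<le> M * length ws"
      by auto
    show ?case
      using \<Gamma>.len_mult_le[OF \<tau>(1) x(1), of s] M(2)[of s] \<tau>[of s] x Cons.prems
      by (intro bexI[of _ "\<tau> s \<otimes>\<^bsub>\<Gamma>\<^esub> x"]) (auto simp: algebra_simps)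
  qed
  have "\<exists>x. x \<in> carrier \<Gamma> \<and> \<pi> x = g \<and> word_length \<Gamma> T x \<le> M * len g" if "g \<in> carrier G" for g
  proof -
    obtain ws where "set ws \<subseteq> S" "word_prod ws = g" "len g = real (length ws)"
      using geodesic_word[OF \<open>g \<in> carrier G\<close>] .
    then show ?thesis using lift by force
  qed
  then show thesis using that[OF M(1)] by metis
qed

end

lemma hyperbolic_group_graph_metric:
  assumes "hyperbolic_group G"
  obtains T e N where "word_metric_group G T"
    "hyperbolic_graph_metric (carrier G) (length_metric G (word_length G T)) e N \<one>\<^bsub>G\<^esub>"
proof -
  obtain T where "group G" and T: "finite_symmetric_generating_set G T"
    and hyp: "gromov_hyperbolic (carrier G) (length_metric G (word_length G T))"
    using assms by (auto simp: hyperbolic_group_def)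
  then interpret word_metric_group G T
    by (simp add: word_metric_group_def word_metric_group_axioms_def)
  interpret graph_metric "carrier G" wdist by (rule graph_metric_wdist)
  from hyp obtain e where "e \<ge> 0" and e: "\<forall>w\<in>carrier G. \<forall>x\<in>carrier G. \<forall>y\<in>carrier G. \<forall>z\<in>carrier G.
      gromov_product wdist w x z \<ge> min (gromov_product wdist w x y) (gromov_product wdist w y z) - e"
    unfolding gromov_hyperbolic_def by blast
  have "hyperbolic_graph_metric (carrier G) wdist e (card {g \<in> carrier G. len g \<le> 4 * e}) \<one>\<^bsub>G\<^esub>"
    by unfold_locales
      (use \<open>e \<ge> 0\<close> e finite_wdist_ball card_wdist_ball_le in auto)
  then show thesis by (rule that[OF word_metric_group_axioms])
qed


section \<open>Group extensions\<close>

text \<open>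
  A point \<open>x\<close> is moved to the fibre over \<open>p\<close> by right multiplication with the section at \<open>(\<pi> x)\<inverse> p\<close>,
  which shifts it by \<open>O(d (\<pi> x) p)\<close>; left multiplication with \<open>(\<sigma> p)\<inverse>\<close> is an isometry from that fibre to
  the kernel. This defines \<open>k x p\<close>, and distances between \<open>k x p\<close> and \<open>k y p\<close> differ from those between \<open>x\<close>
  and \<open>y\<close> only by the two shifts. Composition with a map on the kernel that realises \<open>\<beta>\<close> gives the
  fibre positions.
\<close>

lemma compression_exponent_extension:
  fixes H :: "('h, 'u) monoid_scheme" and \<Gamma> :: "('a, 'v) monoid_scheme"
    and G :: "('g, 'w) monoid_scheme"
  assumes "group H" and "group \<Gamma>" and "group G"
    and \<iota>: "\<iota> \<in> mon H \<Gamma>" and \<pi>: "\<pi> \<in> epi \<Gamma> G" and exact: "\<iota> ` carrier H = kernel \<Gamma> G \<pi>"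
    and S: "finite_symmetric_generating_set \<Gamma> S"
    and hyp: "hyperbolic_group G"
    and exponent: "compression_exponent (carrier H) (length_metric H (\<lambda>h. word_length \<Gamma> S (\<iota> h))) \<beta>"
    and "\<beta> > 0"
  shows "compression_exponent (carrier \<Gamma>) (length_metric \<Gamma> (word_length \<Gamma> S)) (\<beta> / 5)"
proof -
  interpret H: group H by fact
  interpret \<Gamma>: word_metric_group \<Gamma> S
    using assms by (simp add: word_metric_group_def word_metric_group_axioms_def)
  interpret \<iota>: group_hom H \<Gamma> \<iota>
    using \<iota> assms(1,2) by (simp add: group_hom_def group_hom_axioms_def mon_def)
  interpret \<pi>: group_hom \<Gamma> G \<pi>
    using \<pi> assms(2,3) by (simp add: group_hom_def group_hom_axioms_def epi_def)
  obtain T e N where "word_metric_group G T" and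
    "hyperbolic_graph_metric (carrier G) (length_metric G (word_length G T)) e N \<one>\<^bsub>G\<^esub>"
    using hyperbolic_group_graph_metric[OF hyp] .
  then interpret G: word_metric_group G T +
    dG: hyperbolic_graph_metric "carrier G" "length_metric G (word_length G T)" e N "\<one>\<^bsub>G\<^esub>"
    by simp_all
  obtain \<sigma> M where "M \<ge> 0" and \<sigma>: "\<And>g. g \<in> carrier G \<Longrightarrow>
      \<sigma> g \<in> carrier \<Gamma> \<and> \<pi> (\<sigma> g) = g \<and> \<Gamma>.len (\<sigma> g) \<le> M * G.len g"
    using G.linear_section[OF \<open>group \<Gamma>\<close> \<pi> S] by metis
  obtain f :: "'h \<Rightarrow> ('h \<times> nat) ell2" and C C' c c' where
    const: "\<beta> \<le> 1" "C > 0" "C' > 0" "c \<ge> 0" "c' \<ge> 0" and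
    f_lower: "\<And>x y. x \<in> carrier H \<Longrightarrow> y \<in> carrier H \<Longrightarrow>
      1 / C' * \<Gamma>.len (\<iota> (inv\<^bsub>H\<^esub> x \<otimes>\<^bsub>H\<^esub> y)) powr \<beta> - c' \<le> norm (f x - f y)" and
    f_upper: "\<And>x y. x \<in> carrier H \<Longrightarrow> y \<in> carrier H \<Longrightarrow>
      norm (f x - f y) \<le> C * \<Gamma>.len (\<iota> (inv\<^bsub>H\<^esub> x \<otimes>\<^bsub>H\<^esub> y)) + c"
    using exponent unfolding compression_exponent_def length_metric_def by metis
  define a where "a x p = \<sigma> (inv\<^bsub>G\<^esub> \<pi> x \<otimes>\<^bsub>G\<^esub> p)" for x p
  define k where "k x p = inv\<^bsub>\<Gamma>\<^esub> \<sigma> p \<otimes>\<^bsub>\<Gamma>\<^esub> (x \<otimes>\<^bsub>\<Gamma>\<^esub> a x p)" for x p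
  define h where "h x p = inv_into (carrier H) \<iota> (k x p)" for x p
  have a: "a x p \<in> carrier \<Gamma>" "\<pi> (a x p) = inv\<^bsub>G\<^esub> \<pi> x \<otimes>\<^bsub>G\<^esub> p"
    "\<Gamma>.len (a x p) \<le> M * G.wdist (\<pi> x) p" if "x \<in> carrier \<Gamma>" "p \<in> carrier G" for x p
    using \<sigma>[of "inv\<^bsub>G\<^esub> \<pi> x \<otimes>\<^bsub>G\<^esub> p"] that by (auto simp: a_def length_metric_def)
  have k: "k x p \<in> carrier \<Gamma>" "\<pi> (k x p) = \<one>\<^bsub>G\<^esub>" if "x \<in> carrier \<Gamma>" "p \<in> carrier G" for x p
    using \<sigma>[OF that(2)] a[OF that] that by (auto simp: k_def G.mult_inv_cancel_left)
  have h: "h x p \<in> carrier H" "\<iota> (h x p) = k x p" if "x \<in> carrier \<Gamma>" "p \<in> carrier G" for x p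
  proof -
    have "k x p \<in> \<iota> ` carrier H" using k[OF that] unfolding exact by (simp add: kernel_def)
    then show "h x p \<in> carrier H" "\<iota> (h x p) = k x p"
      unfolding h_def by (rule inv_into_into, rule f_inv_into_f)
  qed
  have len_h: "\<bar>\<Gamma>.len (\<iota> (inv\<^bsub>H\<^esub> (h x p) \<otimes>\<^bsub>H\<^esub> h y p)) - \<Gamma>.wdist x y\<bar> \<le> 2 * M * R"
    if xy: "x \<in> carrier \<Gamma>" "y \<in> carrier \<Gamma>" and p: "p \<in> carrier G"
      and R: "G.wdist (\<pi> x) p \<le> R" "G.wdist (\<pi> y) p \<le> R" for x y p R
  proof -
    define g where "g = inv\<^bsub>\<Gamma>\<^esub> x \<otimes>\<^bsub>\<Gamma>\<^esub> y"
    define w where "w = inv\<^bsub>\<Gamma>\<^esub> (a x p) \<otimes>\<^bsub>\<Gamma>\<^esub> (g \<otimes>\<^bsub>\<Gamma>\<^esub> a y p)"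
    note ax = a[OF xy(1) p] and ay = a[OF xy(2) p]
    have g: "g \<in> carrier \<Gamma>" and w: "w \<in> carrier \<Gamma>" using xy ax ay by (auto simp: g_def w_def)
    have "\<iota> (inv\<^bsub>H\<^esub> (h x p) \<otimes>\<^bsub>H\<^esub> h y p) = inv\<^bsub>\<Gamma>\<^esub> (k x p) \<otimes>\<^bsub>\<Gamma>\<^esub> k y p"
      using h[OF xy(1) p] h[OF xy(2) p] by simp
    also have "\<dots> = w"
      using \<sigma>[OF p] xy ax ay
      by (simp add: k_def w_def g_def \<Gamma>.inv_mult_group \<Gamma>.m_assoc \<Gamma>.mult_inv_cancel_left)
    finally have 1: "\<iota> (inv\<^bsub>H\<^esub> (h x p) \<otimes>\<^bsub>H\<^esub> h y p) = w" .
    have small: "\<Gamma>.len (a x p) \<le> M * R" "\<Gamma>.len (a y p) \<le> M * R"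
      using ax(3) ay(3) mult_left_mono[OF R(1) \<open>M \<ge> 0\<close>] mult_left_mono[OF R(2) \<open>M \<ge> 0\<close>] by linarith+
    have "\<Gamma>.len w \<le> \<Gamma>.len (a x p) + (\<Gamma>.len g + \<Gamma>.len (a y p))"
      using \<Gamma>.len_mult_le[of "inv\<^bsub>\<Gamma>\<^esub> (a x p)" "g \<otimes>\<^bsub>\<Gamma>\<^esub> a y p"] \<Gamma>.len_mult_le[OF g ay(1)]
        \<Gamma>.len_inv[OF ax(1)] g ax(1) ay(1) by (simp add: w_def)
    moreover have "g = a x p \<otimes>\<^bsub>\<Gamma>\<^esub> (w \<otimes>\<^bsub>\<Gamma>\<^esub> inv\<^bsub>\<Gamma>\<^esub> (a y p))"
      using g ax(1) ay(1) by (simp add: w_def \<Gamma>.m_assoc \<Gamma>.mult_inv_cancel_left)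
    then have "\<Gamma>.len g \<le> \<Gamma>.len (a x p) + (\<Gamma>.len w + \<Gamma>.len (a y p))"
      using \<Gamma>.len_mult_le[of "a x p" "w \<otimes>\<^bsub>\<Gamma>\<^esub> inv\<^bsub>\<Gamma>\<^esub> (a y p)"] \<Gamma>.len_mult_le[of w "inv\<^bsub>\<Gamma>\<^esub> (a y p)"]
        \<Gamma>.len_inv[OF ay(1)] w ax(1) ay(1) by simp
    ultimately show ?thesis
      using small unfolding 1 by (simp add: length_metric_def g_def)
  qed
  obtain L :: nat where L: "\<And>x. x \<in> carrier \<Gamma> \<Longrightarrow> \<Gamma>.len x \<le> 1 \<Longrightarrow> G.len (\<pi> x) \<le> real L"
  proof
    let ?B = "{x \<in> carrier \<Gamma>. \<Gamma>.len x \<le> 1}"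
    show "G.len (\<pi> x) \<le> real (nat \<lceil>\<Sum>x\<in>?B. G.len (\<pi> x)\<rceil>)" if "x \<in> carrier \<Gamma>" "\<Gamma>.len x \<le> 1" for x
    proof -
      have "G.len (\<pi> x) \<le> (\<Sum>x\<in>?B. G.len (\<pi> x))"
        by (rule member_le_sum) (use that \<Gamma>.finite_len_ball G.len_nonneg in auto)
      then show ?thesis by linarith
    qed
  qed
  show ?thesis
  proof (rule dG.compression_exponent_over_hyperbolic[where \<pi> = \<pi> and u = "\<lambda>x p. f (h x p)"
        and L = L and C = C and C' = C' and c = c and c' = c' and M = "2 * M"])
    show "graph_metric (carrier \<Gamma>) \<Gamma>.wdist" by (rule \<Gamma>.graph_metric_wdist)
    show "G.wdist (\<pi> x) (\<pi> y) \<le> L" if "x \<in> carrier \<Gamma>" "y \<in> carrier \<Gamma>" "\<Gamma>.wdist x y \<le> 1" for x y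
      using L[of "inv\<^bsub>\<Gamma>\<^esub> x \<otimes>\<^bsub>\<Gamma>\<^esub> y"] that by (simp add: length_metric_def)
  next
    fix x y p R assume *: "x \<in> carrier \<Gamma>" "y \<in> carrier \<Gamma>" "p \<in> carrier G"
      "G.wdist (\<pi> x) p \<le> R" "G.wdist (\<pi> y) p \<le> R"
    note h = h[OF *(1,3)] h[OF *(2,3)] and len = len_h[OF *]
    have "\<Gamma>.len (\<iota> (inv\<^bsub>H\<^esub> (h x p) \<otimes>\<^bsub>H\<^esub> h y p)) \<le> \<Gamma>.wdist x y + 2 * M * R"
      using len by linarith
    then have "C * \<Gamma>.len (\<iota> (inv\<^bsub>H\<^esub> (h x p) \<otimes>\<^bsub>H\<^esub> h y p)) \<le> C * (\<Gamma>.wdist x y + 2 * M * R)"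
      using const by (intro mult_left_mono) auto
    then show "norm (f (h x p) - f (h y p)) \<le> C * (\<Gamma>.wdist x y + 2 * M * R) + c"
      using f_upper[OF h(1,3)] by linarith
    assume "2 * M * R \<le> \<Gamma>.wdist x y"
    then have "(\<Gamma>.wdist x y - 2 * M * R) powr \<beta> \<le> \<Gamma>.len (\<iota> (inv\<^bsub>H\<^esub> (h x p) \<otimes>\<^bsub>H\<^esub> h y p)) powr \<beta>"
      using len \<open>\<beta> > 0\<close> by (intro powr_mono2) auto
    then have "1 / C' * (\<Gamma>.wdist x y - 2 * M * R) powr \<beta> \<le> 1 / C' * \<Gamma>.len (\<iota> (inv\<^bsub>H\<^esub> (h x p) \<otimes>\<^bsub>H\<^esub> h y p)) powr \<beta>"
      using const by (intro mult_left_mono) auto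
    then show "1 / C' * (\<Gamma>.wdist x y - 2 * M * R) powr \<beta> - c' \<le> norm (f (h x p) - f (h y p))"
      using f_lower[OF h(1,3)] by linarith
  qed (use const \<open>\<beta> > 0\<close> \<open>M \<ge> 0\<close> in auto)
qed

theorem theorem1p4:
  fixes H :: "('h, 'u) monoid_scheme" and \<Gamma> :: "('a, 'v) monoid_scheme"
    and G :: "('g, 'w) monoid_scheme"
    and \<iota> :: "'h \<Rightarrow> 'a" and \<pi> :: "'a \<Rightarrow> 'g" and S :: "'a set" and \<delta> :: real
  assumes "group H" and "group \<Gamma>" and "group G"
    and "\<iota> \<in> mon H \<Gamma>" and "\<pi> \<in> epi \<Gamma> G" and "\<iota> ` carrier H = kernel \<Gamma> G \<pi>"
    and "finite_symmetric_generating_set \<Gamma> S"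
    and "hyperbolic_group G"
    and "hilbert_compression (carrier H) (length_metric H (\<lambda>h. word_length \<Gamma> S (\<iota> h))) = \<delta>"
  shows "hilbert_compression (carrier \<Gamma>) (length_metric \<Gamma> (word_length \<Gamma> S)) \<ge> \<delta> / 5"
proof -
  let ?dH = "length_metric H (\<lambda>h. word_length \<Gamma> S (\<iota> h))" and ?d\<Gamma> = "length_metric \<Gamma> (word_length \<Gamma> S)"
  have nonneg: "?dH x y \<ge> 0" "?d\<Gamma> v w \<ge> 0" for x y v w
    by (simp_all add: length_metric_def word_length_def)
  have "\<beta> \<le> 5 * hilbert_compression (carrier \<Gamma>) ?d\<Gamma>" if \<beta>: "compression_exponent (carrier H) ?dH \<beta>" for \<beta>
  proof -
    have "compression_exponent (carrier \<Gamma>) ?d\<Gamma> (\<beta> / 5)"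
    proof (cases "\<beta> > 0")
      case True
      show ?thesis by (rule compression_exponent_extension[OF assms(1-8) \<beta> True])
    next
      case False
      then have "\<beta> = 0" using \<beta> by (simp add: compression_exponent_def)
      then show ?thesis using compression_exponent_0[of "carrier \<Gamma>" ?d\<Gamma>] nonneg by simp
    qed
    then have "\<beta> / 5 \<le> hilbert_compression (carrier \<Gamma>) ?d\<Gamma>"
      unfolding hilbert_compression_def by (intro cSup_upper bdd_above_compression_exponent) simp
    then show ?thesis by simp
  qed
  moreover have "compression_exponent (carrier H) ?dH 0"
    by (rule compression_exponent_0) (rule nonneg)
  ultimately have "hilbert_compression (carrier H) ?dH \<le> 5 * hilbert_compression (carrier \<Gamma>) ?d\<Gamma>"
    unfolding hilbert_compression_def[of "carrier H"] by (intro cSup_least) auto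
  then show ?thesis using assms(9) by simp
qed

end
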